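(* Let $N\geqslant 4$ and let $\mathcal C$ be a category of noncrossing $\{x,y\}$-coloured partitions ($x^{-1}=x$, $y^{-1}=y$) with $\pi(x,y)\notin\mathcal C$, which is not a free product, all of whose blocks have even size, and which contains a partition with a block of size at least four. Then there exist integers $d,n\geqslant 0$ with $n\mid d$ such that $\mathcal C=\mathcal C_{\Gamma_d,\Lambda_n,\{x,y\}}$, i.e. $\mathbb G_N(\mathcal C)=H_N^+(\Gamma_d,\Lambda_n)$, where $\Lambda_n\subset\Gamma_d$ is the subgroup generated by $(xy)^n$.
   Context: Colour sets and partitions: a colour set is a set $\mathcal A$ with an involution $a\mapsto a^{-1}$. For words $w,w'$ on $\mathcal A$, an element of $P^{\mathcal A}(w,w')$ is a partition of $|w|+|w'|$ points drawn as an upper row coloured (left to right) by $w$ and a lower row coloured by $w'$; its subsets are called blocks. It is noncrossing if there are no four points $k_1<k_2<k_3<k_4$ (ordering: upper row left to right, then lower row right to left) with $k_1,k_3$ in one block and $k_2,k_4$ in a different block. Category operations: tensor product (horizontal juxtaposition), composition $qp$ (stack $q$ below $p$, erase middle points and closed loops), adjoint $p^*$ (reflection), rotation (move an extreme point of one row to the same end of the other row, replacing its colour $a$ by $a^{-1}$). A category of noncrossing partitions is a family $\mathcal C(w,w')\subset NC^{\mathcal A}(w,w')$ stable under these operations and containing $\pi(a,a)$ for all $a$. $\mathbb G_N(\mathcal C)$ is the unique compact quantum group with $N$-dimensional unitary representations $u^a$ generating $C(\mathbb G_N(\mathcal C))$ such that $\mathrm{Mor}(u^{\otimes w},u^{\otimes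 w'})$ is spanned by the maps $T_p$, $p\in\mathcal C(w,w')$, where $T_p(e_{i})=\sum_j\delta_p(i,j)e_j$ with $\delta_p(i,j)=1$ iff indices in a common block are equal. Notation: $\pi(w,w')$ is the one-block partition; $\beta(w,w')$ is the partition whose blocks are the set of all upper points and the set of all lower points. For a category $\mathcal C$ on $\{x,y\}$, $\mathcal C_x$ (resp. $\mathcal C_y$) consists of its partitions all of whose points are coloured $x$ (resp. $y$); $\mathcal C$ is a free product if it is generated by $\mathcal C_x\cup\mathcal C_y$. Free wreath products of pairs: let $\Gamma$ be a group with symmetric generating set $S$ (colour set $S$ with involution $g\mapsto g^{-1}$). $\mathcal C_{\Gamma,S}$ is the category of all $S$-coloured noncrossing partitions such that for each block the product in $\Gamma$ of the colours of its upper points (left to right) equals the product of the colours of its lower points (left to right; an empty product is $e$). For $\lambda=g_1\cdots g_n$ ($g_i\in S$) let $\beta_\lambda=\beta(g_1\cdots g_n,g_1\cdots g_n)$. For a subgroup $\Lambda\subset\Gamma$, $\mathcal C_{\Gamma,\Lambda,S}$ is the category generated by $\mathcal C_{\Gamma,S}$ and all $\beta_\lambda$, $\lambda\in\Lambda$, and $H_N^+(\Gamma,\Lambda)=\mathbb G_N(\mathcal C_{\Gamma,\Lambda,S})$. For $d\geqslant1$, $\Gamma_d$ is the quotient of $\mathbb Z_2*\mathbb Z_2=\langle x,y\mid x^2=y^2=1\rangle$ by $(xy)^d=e$, and $\Gamma_0=\mathbb Z_2*\mathbb Z_2$; the generating set is $\{x,y\}$. Every integer divides $0$. *)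

theory Defs
  imports Main "HOL-Library.Disjoint_Sets"
begin

datatype col = X | Y

text \<open>A point is (False, i) = i-th upper point, (True, j) = j-th lower point,
  indices counted from the left starting at 0.\<close>
type_synonym pt = "bool \<times> nat"

datatype part = Part (up: "col list") (lo: "col list") (blocks: "pt set set")

definition points :: "col list \<Rightarrow> col list \<Rightarrow> pt set" where
  "points w w' = {(False, i) | i. i < length w} \<union> {(True, j) | j. j < length w'}"

definition wf_part :: "part \<Rightarrow> bool" where
  "wf_part p = partition_on (points (up p) (lo p)) (blocks p)"

text \<open>Position in the cyclic order: upper row left to right, then lower row right to left.\<close>
fun pos :: "part \<Rightarrow> pt \<Rightarrow> nat" where
  "pos p (False, i) = i"
| "pos p (True, j) = length (up p) + (length (lo p) - 1 - j)"

definition noncrossing :: "part \<Rightarrow> bool" where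
  "noncrossing p = (wf_part p \<and>
     \<not> (\<exists>B1\<in>blocks p. \<exists>B2\<in>blocks p. B1 \<noteq> B2 \<and>
          (\<exists>a b c e. a \<in> B1 \<and> c \<in> B1 \<and> b \<in> B2 \<and> e \<in> B2 \<and>
             pos p a < pos p b \<and> pos p b < pos p c \<and> pos p c < pos p e)))"

fun shift :: "nat \<Rightarrow> nat \<Rightarrow> pt \<Rightarrow> pt" where
  "shift m m' (False, i) = (False, i + m)"
| "shift m m' (True, j) = (True, j + m')"

definition tensor :: "part \<Rightarrow> part \<Rightarrow> part" where
  "tensor p q = Part (up p @ up q) (lo p @ lo q)
     (blocks p \<union> (image (shift (length (up p)) (length (lo p)))) ` blocks q)"

fun flip :: "pt \<Rightarrow> pt" where
  "flip (b, i) = (\<not> b, i)"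

definition adj :: "part \<Rightarrow> part" where
  "adj p = Part (lo p) (up p) ((image flip) ` blocks p)"

text \<open>Composition q p: q stacked below p (meaningful when lo p = up q).
  Layers: 0 = upper row of p, 1 = middle row, 2 = lower row of q.\<close>
fun layP :: "pt \<Rightarrow> nat \<times> nat" where
  "layP (False, i) = (0, i)"
| "layP (True, j) = (1, j)"

fun layQ :: "pt \<Rightarrow> nat \<times> nat" where
  "layQ (False, j) = (1, j)"
| "layQ (True, k) = (2, k)"

fun outer :: "pt \<Rightarrow> nat \<times> nat" where
  "outer (False, i) = (0, i)"
| "outer (True, k) = (2, k)"

definition comp_rel :: "part \<Rightarrow> part \<Rightarrow> ((nat \<times> nat) \<times> (nat \<times> nat)) set" where
  "comp_rel q p =
     {(a, b). \<exists>B\<in>blocks p. a \<in> layP ` B \<and> b \<in> layP ` B} \<union>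
     {(a, b). \<exists>B\<in>blocks q. a \<in> layQ ` B \<and> b \<in> layQ ` B}"

definition comp :: "part \<Rightarrow> part \<Rightarrow> part" where
  "comp q p = Part (up p) (lo q)
     {{s \<in> points (up p) (lo q). (outer t, outer s) \<in> (comp_rel q p)\<^sup>*} | t. t \<in> points (up p) (lo q)}"

text \<open>Rotations (colour a replaced by a^-1 = a). UL: leftmost upper point to leftmost lower;
  LU: the converse; UR: rightmost upper point to rightmost lower; LR: the converse.\<close>
fun fUL :: "pt \<Rightarrow> pt" where
  "fUL (False, 0) = (True, 0)"
| "fUL (False, Suc i) = (False, i)"
| "fUL (True, j) = (True, Suc j)"

fun fLU :: "pt \<Rightarrow> pt" where
  "fLU (True, 0) = (False, 0)"
| "fLU (True, Suc j) = (True, j)"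
| "fLU (False, i) = (False, Suc i)"

definition rotUL :: "part \<Rightarrow> part" where
  "rotUL p = Part (tl (up p)) (hd (up p) # lo p) ((image fUL) ` blocks p)"

definition rotLU :: "part \<Rightarrow> part" where
  "rotLU p = Part (hd (lo p) # up p) (tl (lo p)) ((image fLU) ` blocks p)"

definition fUR :: "nat \<Rightarrow> nat \<Rightarrow> pt \<Rightarrow> pt" where
  "fUR m m' t = (if t = (False, m - 1) then (True, m') else t)"

definition fLR :: "nat \<Rightarrow> nat \<Rightarrow> pt \<Rightarrow> pt" where
  "fLR m m' t = (if t = (True, m' - 1) then (False, m) else t)"

definition rotUR :: "part \<Rightarrow> part" where
  "rotUR p = Part (butlast (up p)) (lo p @ [last (up p)])
     ((image (fUR (length (up p)) (length (lo p)))) ` blocks p)"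

definition rotLR :: "part \<Rightarrow> part" where
  "rotLR p = Part (up p @ [last (lo p)]) (butlast (lo p))
     ((image (fLR (length (up p)) (length (lo p)))) ` blocks p)"

definition pi_part :: "col list \<Rightarrow> col list \<Rightarrow> part" where
  "pi_part w w' = Part w w' ({points w w'} - {{}})"

definition beta_part :: "col list \<Rightarrow> col list \<Rightarrow> part" where
  "beta_part w w' = Part w w'
     ({{(False, i) | i. i < length w}, {(True, j) | j. j < length w'}} - {{}})"

definition is_category :: "part set \<Rightarrow> bool" where
  "is_category C =
     ((\<forall>p\<in>C. noncrossing p) \<and>
      (\<forall>p\<in>C. \<forall>q\<in>C. tensor p q \<in> C) \<and>
      (\<forall>p\<in>C. \<forall>q\<in>C. lo p = up q \<longrightarrow> comp q p \<in> C) \<and>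
      (\<forall>p\<in>C. adj p \<in> C) \<and>
      (\<forall>p\<in>C. up p \<noteq> [] \<longrightarrow> rotUL p \<in> C) \<and>
      (\<forall>p\<in>C. lo p \<noteq> [] \<longrightarrow> rotLU p \<in> C) \<and>
      (\<forall>p\<in>C. up p \<noteq> [] \<longrightarrow> rotUR p \<in> C) \<and>
      (\<forall>p\<in>C. lo p \<noteq> [] \<longrightarrow> rotLR p \<in> C) \<and>
      (\<forall>a. pi_part [a] [a] \<in> C))"

definition gen_cat :: "part set \<Rightarrow> part set" where
  "gen_cat S = \<Inter> {D. is_category D \<and> S \<subseteq> D}"

definition mono_part :: "col \<Rightarrow> part \<Rightarrow> bool" where
  "mono_part a p = (set (up p) \<subseteq> {a} \<and> set (lo p) \<subseteq> {a})"

definition free_product :: "part set \<Rightarrow> bool" where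
  "free_product C = (C = gen_cat ({p \<in> C. mono_part X p} \<union> {p \<in> C. mono_part Y p}))"

definition xy_pow :: "nat \<Rightarrow> col list" where
  "xy_pow k = concat (replicate k [X, Y])"

definition yx_pow :: "nat \<Rightarrow> col list" where
  "yx_pow k = concat (replicate k [Y, X])"

text \<open>Equality in Gamma_d = <x,y | x^2 = y^2 = (xy)^d = e> of the products of two words.
  For d = 0 the relator (xy)^0 is the empty word, so Gamma_0 = Z2 * Z2.\<close>
inductive gamma_eq :: "nat \<Rightarrow> col list \<Rightarrow> col list \<Rightarrow> bool" for d where
  refl: "gamma_eq d w w"
| sym: "gamma_eq d u v \<Longrightarrow> gamma_eq d v u"
| trans: "gamma_eq d u v \<Longrightarrow> gamma_eq d v w \<Longrightarrow> gamma_eq d u w"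
| relX: "gamma_eq d (u @ [X, X] @ v) (u @ v)"
| relY: "gamma_eq d (u @ [Y, Y] @ v) (u @ v)"
| relD: "gamma_eq d (u @ xy_pow d @ v) (u @ v)"

definition ucols :: "part \<Rightarrow> pt set \<Rightarrow> col list" where
  "ucols p B = map (\<lambda>i. up p ! i) (sorted_list_of_set {i. (False, i) \<in> B})"

definition lcols :: "part \<Rightarrow> pt set \<Rightarrow> col list" where
  "lcols p B = map (\<lambda>j. lo p ! j) (sorted_list_of_set {j. (True, j) \<in> B})"

definition C_Gamma :: "nat \<Rightarrow> part set" where
  "C_Gamma d = {p. noncrossing p \<and> (\<forall>B\<in>blocks p. gamma_eq d (ucols p B) (lcols p B))}"

text \<open>A word represents an element of Lambda_n = <(xy)^n> \<subseteq> Gamma_d.\<close>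
definition in_Lambda :: "nat \<Rightarrow> nat \<Rightarrow> col list \<Rightarrow> bool" where
  "in_Lambda d n w = (\<exists>k. gamma_eq d w (xy_pow (n * k)) \<or> gamma_eq d w (yx_pow (n * k)))"

definition C_Gamma_Lambda :: "nat \<Rightarrow> nat \<Rightarrow> part set" where
  "C_Gamma_Lambda d n = gen_cat (C_Gamma d \<union> {beta_part w w | w. in_Lambda d n w})"

end

theory Submission
  imports Defs
begin

text \<open>
  Rotation identifies a category with its one-row partitions, which are encoded as words whose
  letters carry a block label; composition then reduces to capping two adjacent letters of equal
  colour, which merges their labels. If no block of \<open>C\<close> uses both colours, interval blocks can be
  removed and reinserted one at a time, so \<open>C\<close> is a free product. Otherwise a mixed word of minimal
  length together with a block of size four yields the one-block partition on \<open>xyyx\<close>, and hence all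
  \<open>\<pi>(ab,ab)\<close>, so that blocks of adjacent points can be merged inside \<open>C\<close>.

  The words whose one-block partition lies in \<open>C\<close> are then invariant under the relations of
  \<open>\<Gamma>\<^sub>0\<close>, and so are the words \<open>w\<close> with \<open>\<beta>(w,w) \<in> C\<close>. Let \<open>d\<close> and \<open>n\<close> generate the exponents \<open>k\<close>
  for which \<open>(xy)\<^sup>k\<close> is of the first, respectively the second kind. Any element of \<open>C\<close> is recovered
  from one-block partitions by splitting off interval blocks \<open>b\<close> with \<open>\<beta>(b,b)\<close>, and \<open>\<beta>(b,b) \<in> C\<close>
  because it arises from composing the partition with its adjoint.
\<close>

section \<open>Partitions as labelled words\<close>

text \<open>The partition of \<open>A\<close> into the fibres of \<open>g\<close>. Storing blocks as
  fibres of a labelling turns merging of blocks into identification of labels.\<close>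

definition kerp :: "'a set \<Rightarrow> ('a \<Rightarrow> 'b) \<Rightarrow> 'a set set" where
  "kerp A g = (\<lambda>t. {s \<in> A. g s = g t}) ` A"

lemma kerp_cong:
  assumes "\<And>s t. s \<in> A \<Longrightarrow> t \<in> A \<Longrightarrow> (g s = g t) = (h s = h t)"
  shows "kerp A g = kerp A h"
proof -
  have "{s \<in> A. g s = g t} = {s \<in> A. h s = h t}" if "t \<in> A" for t using assms that by auto
  then show ?thesis unfolding kerp_def by (intro image_cong) auto
qed

lemma kerp_image:
  assumes "\<And>t. t \<in> A \<Longrightarrow> h (f t) = g t"
  shows "image f ` kerp A g = kerp (f ` A) h"
proof -
  have "f ` {s \<in> A. g s = g t} = {s \<in> f ` A. h s = h (f t)}" if "t \<in> A" for t
    using assms that by (auto simp: image_iff)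
  then show ?thesis unfolding kerp_def image_image by (intro image_cong) auto
qed

lemma kerp_Un:
  assumes "\<And>s t. s \<in> A \<Longrightarrow> t \<in> B \<Longrightarrow> g s \<noteq> g t"
  shows "kerp (A \<union> B) g = kerp A g \<union> kerp B g"
proof -
  have "{s \<in> A \<union> B. g s = g t} = {s \<in> A. g s = g t}" if "t \<in> A" for t
    using assms that by auto metis
  moreover have "{s \<in> A \<union> B. g s = g t} = {s \<in> B. g s = g t}" if "t \<in> B" for t
    using assms that by auto
  ultimately show ?thesis unfolding kerp_def by (simp add: image_Un)
qed

text \<open>Finitely many blocks can be numbered; each point is labelled by the number of its
  block.\<close>

lemma partition_on_kerp:
  assumes "partition_on A P" "finite A"
  shows "\<exists>g :: 'a \<Rightarrow> nat. P = kerp A g"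
proof -
  have "finite P" using assms finite_elements by blast
  then obtain e :: "'a set \<Rightarrow> nat" where e: "inj_on e P"
    using finite_imp_inj_to_nat_seg by blast
  define blk where "blk t = (THE B. B \<in> P \<and> t \<in> B)" for t
  have blk: "blk t = B" if "B \<in> P" "t \<in> B" for t B
    unfolding blk_def using that assms(1)
    by (intro the_equality) (auto simp: partition_on_def disjoint_def)
  have mem: "\<exists>B\<in>P. t \<in> B" if "t \<in> A" for t
    using that assms(1) by (auto simp: partition_on_def)
  have sub: "B \<subseteq> A" if "B \<in> P" for B using that assms(1) by (auto simp: partition_on_def)
  have cls: "{s \<in> A. e (blk s) = e (blk t)} = B" if "B \<in> P" "t \<in> B" for B t
  proof -
    have "e (blk s) = e (blk t) \<longleftrightarrow> s \<in> B" if "s \<in> A" for s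
    proof -
      obtain B' where "B' \<in> P" "s \<in> B'" using mem \<open>s \<in> A\<close> by blast
      then show ?thesis using blk \<open>B \<in> P\<close> \<open>t \<in> B\<close> e by (metis inj_onD)
    qed
    then show ?thesis using sub that by auto
  qed
  have "P = kerp A (\<lambda>t. e (blk t))"
  proof (intro equalityI subsetI)
    fix B assume "B \<in> P"
    then obtain t where "t \<in> B" using assms(1) unfolding partition_on_def by fastforce
    then show "B \<in> kerp A (\<lambda>t. e (blk t))"
      unfolding kerp_def using cls[OF \<open>B \<in> P\<close> \<open>t \<in> B\<close>] sub \<open>B \<in> P\<close> by blast
  next
    fix B assume "B \<in> kerp A (\<lambda>t. e (blk t))"
    then obtain t where "t \<in> A" "B = {s \<in> A. e (blk s) = e (blk t)}" by (auto simp: kerp_def)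
    then show "B \<in> P" using mem cls by metis
  qed
  then show ?thesis by blast
qed

text \<open>A letter is a colour with the label of its block. Only equality of labels carries
  meaning, so different words may encode the same partition.\<close>

type_synonym lword = "(col \<times> nat) list"

abbreviation labs :: "lword \<Rightarrow> nat set" where "labs xs \<equiv> snd ` set xs"

definition pts :: "nat \<Rightarrow> nat \<Rightarrow> pt set" where
  "pts m m' = {(False, i) | i. i < m} \<union> {(True, j) | j. j < m'}"

lemma pts_iff [simp]: "(b, i) \<in> pts m m' \<longleftrightarrow> (if b then i < m' else i < m)"
  by (auto simp: pts_def)

lemma points_pts: "points w w' = pts (length w) (length w')"
  by (simp add: points_def pts_def)

lemma finite_pts: "finite (pts m m')"
  by (simp add: pts_def)

fun lab :: "lword \<Rightarrow> lword \<Rightarrow> pt \<Rightarrow> nat" where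
  "lab us ls (False, i) = snd (us ! i)"
| "lab us ls (True, j) = snd (ls ! j)"

text \<open>The two rows share one pool of labels: a label occurring in both rows is a block that
  joins them.\<close>

definition lpart :: "lword \<Rightarrow> lword \<Rightarrow> part" where
  "lpart us ls = Part (map fst us) (map fst ls) (kerp (pts (length us) (length ls)) (lab us ls))"

lemma lpart_sel [simp]:
  "up (lpart us ls) = map fst us" "lo (lpart us ls) = map fst ls"
  "blocks (lpart us ls) = kerp (pts (length us) (length ls)) (lab us ls)"
  by (simp_all add: lpart_def)

lemma wf_part_lpart:
  assumes "wf_part p" shows "\<exists>us ls. p = lpart us ls"
proof -
  obtain w w' P where p: "p = Part w w' P" by (cases p)
  obtain g :: "pt \<Rightarrow> nat" where g: "P = kerp (pts (length w) (length w')) g"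
    using partition_on_kerp[of _ P] assms finite_pts
    by (auto simp: wf_part_def p points_pts)
  define us where "us = map (\<lambda>i. (w ! i, g (False, i))) [0..<length w]"
  define ls where "ls = map (\<lambda>i. (w' ! i, g (True, i))) [0..<length w']"
  have [simp]: "map fst us = w" "map fst ls = w'" "length us = length w" "length ls = length w'"
    by (simp_all add: us_def ls_def o_def map_nth)
  have "P = kerp (pts (length w) (length w')) (lab us ls)"
    unfolding g by (rule kerp_cong) (auto simp: us_def ls_def pts_def)
  then have "p = lpart us ls" by (simp add: p lpart_def)
  then show ?thesis by blast
qed

section \<open>Category operations in terms of labels\<close>

lemma rotLU_lpart: "rotLU (lpart us (x # ls)) = lpart (x # us) ls"
proof -
  have "fLU ` pts (length us) (Suc (length ls)) = pts (Suc (length us)) (length ls)"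
  proof (intro equalityI subsetI)
    fix t assume "t \<in> pts (Suc (length us)) (length ls)"
    then show "t \<in> fLU ` pts (length us) (Suc (length ls))"
      by (intro image_eqI[of _ _ "fUL t"]) (cases t rule: fUL.cases; auto)+
  next
    fix t assume "t \<in> fLU ` pts (length us) (Suc (length ls))"
    then obtain s where "t = fLU s" "s \<in> pts (length us) (Suc (length ls))" by blast
    then show "t \<in> pts (Suc (length us)) (length ls)"
      by (cases s rule: fLU.cases; auto)
  qed
  moreover have "lab (x # us) ls (fLU t) = lab us (x # ls) t" for t
    by (cases t rule: fLU.cases) auto
  ultimately show ?thesis
    by (simp add: rotLU_def lpart_def kerp_image[of _ "lab (x # us) ls"])
qed

lemma rotUR_lpart: "rotUR (lpart (us @ [x]) ls) = lpart us (ls @ [x])"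
proof -
  let ?f = "fUR (Suc (length us)) (length ls)"
  have "?f ` pts (Suc (length us)) (length ls) = pts (length us) (Suc (length ls))"
  proof (intro equalityI subsetI)
    fix t assume "t \<in> pts (length us) (Suc (length ls))"
    then show "t \<in> ?f ` pts (Suc (length us)) (length ls)"
      by (intro image_eqI[of _ _ "fLR (length us) (Suc (length ls)) t"])
        (cases t; auto simp: fLR_def fUR_def split: if_splits)+
  qed (auto simp: fUR_def pts_def)
  moreover have "lab us (ls @ [x]) (?f t) = lab (us @ [x]) ls t"
    if "t \<in> pts (Suc (length us)) (length ls)" for t
    using that by (cases t) (auto simp: fUR_def nth_append pts_def split: if_splits)
  ultimately show ?thesis
    by (simp add: rotUR_def lpart_def kerp_image[of _ "lab us (ls @ [x])"])
qed

lemma rotLR_lpart: "rotLR (lpart us (ls @ [x])) = lpart (us @ [x]) ls"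
proof -
  let ?f = "fLR (length us) (Suc (length ls))"
  have "?f ` pts (length us) (Suc (length ls)) = pts (Suc (length us)) (length ls)"
  proof (intro equalityI subsetI)
    fix t assume "t \<in> pts (Suc (length us)) (length ls)"
    then show "t \<in> ?f ` pts (length us) (Suc (length ls))"
      by (intro image_eqI[of _ _ "fUR (Suc (length us)) (length ls) t"])
        (cases t; auto simp: fLR_def fUR_def split: if_splits)+
  qed (auto simp: fLR_def pts_def)
  moreover have "lab (us @ [x]) ls (?f t) = lab us (ls @ [x]) t"
    if "t \<in> pts (length us) (Suc (length ls))" for t
    using that by (cases t) (auto simp: fLR_def nth_append pts_def split: if_splits)
  ultimately show ?thesis
    by (simp add: rotLR_def lpart_def kerp_image[of _ "lab (us @ [x]) ls"])
qed

lemma adj_lpart: "adj (lpart us ls) = lpart ls us"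
proof -
  have "flip ` pts (length us) (length ls) = pts (length ls) (length us)"
  proof (intro equalityI subsetI)
    fix t assume "t \<in> pts (length ls) (length us)"
    then show "t \<in> flip ` pts (length us) (length ls)"
      by (intro image_eqI[of _ _ "flip t"]) (cases t; auto)+
  qed (auto simp: pts_def)
  moreover have "lab ls us (flip t) = lab us ls t" for t
    by (cases t; cases "fst t") auto
  ultimately show ?thesis
    by (simp add: adj_def lpart_def kerp_image[of _ "lab ls us"])
qed

text \<open>A label shared by the two factors would fuse their blocks, hence the disjointness
  hypothesis.\<close>

lemma tensor_lpart:
  assumes "(labs us \<union> labs ls) \<inter> (labs us' \<union> labs ls') = {}"
  shows "tensor (lpart us ls) (lpart us' ls') = lpart (us @ us') (ls @ ls')"
proof -
  let ?sh = "shift (length us) (length ls)"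
  let ?A = "pts (length us) (length ls)" and ?B = "pts (length us') (length ls')"
  let ?g = "lab (us @ us') (ls @ ls')"
  have 1: "kerp ?A (lab us ls) = kerp ?A ?g"
    by (rule kerp_cong) (auto simp: pts_def nth_append)
  have 2: "image ?sh ` kerp ?B (lab us' ls') = kerp (?sh ` ?B) ?g"
    by (rule kerp_image) (auto simp: pts_def nth_append)
  have AB: "pts (length (us @ us')) (length (ls @ ls')) = ?A \<union> ?sh ` ?B"
  proof (intro equalityI subsetI)
    fix t assume t: "t \<in> pts (length (us @ us')) (length (ls @ ls'))"
    show "t \<in> ?A \<union> ?sh ` ?B"
    proof (cases "t \<in> ?A")
      case False
      then show ?thesis using t
        by (cases t; cases "fst t")
          (auto intro!: image_eqI[of _ _ "(fst t, snd t - (if fst t then length ls else length us))"])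
    qed simp
  qed (auto simp: pts_def)
  have "kerp (?A \<union> ?sh ` ?B) ?g = kerp ?A ?g \<union> kerp (?sh ` ?B) ?g"
  proof (rule kerp_Un)
    fix s t assume "s \<in> ?A" "t \<in> ?sh ` ?B"
    then have "?g s \<in> labs us \<union> labs ls" "?g t \<in> labs us' \<union> labs ls'"
      by (auto simp: pts_def nth_append)
    then show "?g s \<noteq> ?g t" using assms by (metis disjoint_iff)
  qed
  then show ?thesis unfolding tensor_def using 1 2 AB by (simp add: lpart_def)
qed

text \<open>The blocks of a composition are connectivity classes, so computing it amounts to finding
  a labelling \<open>h\<close> of the outer points that detects connectivity.\<close>

lemma comp_eq_kerp:
  assumes "\<And>s t. s \<in> A \<Longrightarrow> t \<in> A \<Longrightarrow> (outer t, outer s) \<in> r\<^sup>* \<longleftrightarrow> h s = h t"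
  shows "{{s \<in> A. (outer t, outer s) \<in> r\<^sup>*} |t. t \<in> A} = kerp A h"
proof -
  have "{s \<in> A. (outer t, outer s) \<in> r\<^sup>*} = {s \<in> A. h s = h t}" if "t \<in> A" for t
    using assms that by blast
  then have "(\<lambda>t. {s \<in> A. (outer t, outer s) \<in> r\<^sup>*}) ` A = (\<lambda>t. {s \<in> A. h s = h t}) ` A"
    by (intro image_cong) auto
  then show ?thesis unfolding kerp_def by blast
qed

lemma comp_rel_lpart:
  "(a, b) \<in> comp_rel (lpart us' ls') (lpart us ls) \<longleftrightarrow>
     (\<exists>s\<in>pts (length us) (length ls). \<exists>t\<in>pts (length us) (length ls).
        lab us ls s = lab us ls t \<and> a = layP s \<and> b = layP t) \<or>
     (\<exists>s\<in>pts (length us') (length ls'). \<exists>t\<in>pts (length us') (length ls').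
        lab us' ls' s = lab us' ls' t \<and> a = layQ s \<and> b = layQ t)"
proof -
  have "(\<exists>B\<in>kerp A g. a \<in> f ` B \<and> b \<in> f ` B) \<longleftrightarrow>
      (\<exists>s\<in>A. \<exists>t\<in>A. g s = g t \<and> a = f s \<and> b = f t)"
    for A and g :: "pt \<Rightarrow> nat" and f :: "pt \<Rightarrow> nat \<times> nat"
  proof
    assume "\<exists>s\<in>A. \<exists>t\<in>A. g s = g t \<and> a = f s \<and> b = f t"
    then obtain s t where st: "s \<in> A" "t \<in> A" "g s = g t" "a = f s" "b = f t" by blast
    then have "a \<in> f ` {s \<in> A. g s = g t}" "b \<in> f ` {s \<in> A. g s = g t}" by auto
    moreover have "{s \<in> A. g s = g t} \<in> kerp A g" unfolding kerp_def using \<open>t \<in> A\<close> by (rule imageI)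
    ultimately show "\<exists>B\<in>kerp A g. a \<in> f ` B \<and> b \<in> f ` B" by (intro bexI conjI)
  next
    assume "\<exists>B\<in>kerp A g. a \<in> f ` B \<and> b \<in> f ` B"
    then obtain t s s' where "t \<in> A" "s \<in> A" "g s = g t" "a = f s" "s' \<in> A" "g s' = g t" "b = f s'"
      by (auto simp: kerp_def)
    then show "\<exists>s\<in>A. \<exists>t\<in>A. g s = g t \<and> a = f s \<and> b = f t"
      by (intro bexI[of _ s] bexI[of _ s']) simp_all
  qed
  then show ?thesis by (simp only: comp_rel_def Un_iff mem_Collect_eq case_prod_conv lpart_sel)
qed

abbreviation relabel :: "(nat \<Rightarrow> nat) \<Rightarrow> lword \<Rightarrow> lword" where
  "relabel f \<equiv> map (apsnd f)"

abbreviation mrg :: "nat \<Rightarrow> nat \<Rightarrow> nat \<Rightarrow> nat" where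
  "mrg i j \<equiv> (\<lambda>k. if k = j then i else k)"

text \<open>The labels \<open>s, s+1, ...\<close> are pairwise distinct; with this word in both
  rows, \<open>lpart\<close> is the identity partition of \<open>w\<close>.\<close>

definition idl :: "nat \<Rightarrow> col list \<Rightarrow> lword" where
  "idl s w = zip w [s..<s + length w]"

lemma length_idl [simp]: "length (idl s w) = length w"
  and map_fst_idl [simp]: "map fst (idl s w) = w"
  by (simp_all only: idl_def length_zip length_upt map_fst_zip diff_add_inverse min.idem)

lemma labs_idl: "labs (idl s w) \<subseteq> {s..<s + length w}"
  by (auto simp: idl_def simp del: upt_Suc dest!: set_zip_rightD)

lemma idl_Cons: "idl s (a # w) = (a, s) # idl (Suc s) w"
  by (simp add: idl_def upt_conv_Cons del: upt_Suc)

lemma snd_idl: "k < length w \<Longrightarrow> snd (idl s w ! k) = s + k"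
  by (simp add: idl_def)

text \<open>The lower factor is the identity on \<open>u\<close> and on \<open>v\<close> with a cap
  on the two middle letters. The cap links the blocks \<open>i\<close> and \<open>j\<close>, and its
  two points are erased.\<close>

lemma comp_cap:
  fixes u v :: lword
  defines "c \<equiv> length u"
  defines "U \<equiv> idl 0 (map fst u)" and "V \<equiv> idl (c + 2) (map fst v)"
  shows "comp (lpart (U @ [(a, c), (a, c)] @ V) (U @ V)) (lpart [] (u @ [(a, i), (a, j)] @ v))
           = lpart [] (relabel (mrg i j) (u @ v))"
proof -
  let ?q = "lpart (U @ [(a, c), (a, c)] @ V) (U @ V)"
  let ?ms = "u @ [(a, i), (a, j)] @ v"
  let ?p = "lpart [] ?ms"
  let ?n = "length u + length v"
  let ?m = "mrg i j"
  define r where "r = comp_rel ?q ?p"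
  have len: "length U = c" "length V = length v" "map fst U = map fst u" "map fst V = map fst v"
    by (simp_all add: U_def V_def c_def)
  have sU: "snd (U ! k) = k" if "k < c" for k
    using that by (simp add: U_def snd_idl c_def)
  have sV: "snd (V ! k) = k + c + 2" if "k < length v" for k
    using that by (simp add: V_def snd_idl)
  \<comment> \<open>The middle position joined to the lower position \<open>k\<close>: the capped
    positions \<open>c\<close> and \<open>c + 1\<close> are skipped. As the labels of
    \<open>V\<close> start at \<open>c + 2\<close>, every upper position of the lower factor except
    \<open>c + 1\<close> is its own label.\<close>
  define e where "e k = (if k < c then k else k + 2)" for k
  have lup: "lab (U @ [(a, c), (a, c)] @ V) (U @ V) (False, k) = (if k = c + 1 then c else k)"
    if "k < ?n + 2" for k
    using that by (cases "k < c"; cases "k = c"; cases "k = c + 1")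
      (auto simp: nth_append len sU sV nth_Cons' c_def[symmetric] not_le Suc_le_eq)
  have llo: "lab (U @ [(a, c), (a, c)] @ V) (U @ V) (True, k) = e k" if "k < ?n" for k
    using that by (auto simp: nth_append len sU sV c_def e_def)
  \<comment> \<open>An invariant of connectivity: the merged label of a middle or lower point. Level
    0 is empty here.\<close>
  define Phi where "Phi x = (case x of (l, k) \<Rightarrow> if l = (1::nat) then ?m (snd (?ms ! k)) else ?m (snd ((u @ v) ! k)))" for x :: "nat \<times> nat"
  have ems: "?ms ! (e k) = (u @ v) ! k" if "k < ?n" for k
    using that by (auto simp: e_def c_def nth_append)
  have msc: "?ms ! c = (a, i)" "?ms ! (c + 1) = (a, j)" by (simp_all add: c_def nth_append)
  have rP: "((1, k), (1, k')) \<in> r"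
    if "k < ?n + 2" "k' < ?n + 2" "snd (?ms ! k) = snd (?ms ! k')" for k k'
    unfolding r_def comp_rel_lpart using that
    by (intro disjI1 bexI[of _ "(True, k)"] bexI[of _ "(True, k')"]) auto
  have rQ: "(layQ s, layQ t) \<in> r"
    if "s \<in> pts (?n + 2) ?n" "t \<in> pts (?n + 2) ?n"
      "lab (U @ [(a, c), (a, c)] @ V) (U @ V) s = lab (U @ [(a, c), (a, c)] @ V) (U @ V) t" for s t
    unfolding r_def comp_rel_lpart using that
    by (intro disjI2 bexI[of _ s] bexI[of _ t]) (auto simp: len c_def)
  have eb: "e k < ?n + 2" "e k \<noteq> c + 1" if "k < ?n" for k using that by (auto simp: e_def)
  have down: "((2, k), (1, e k)) \<in> r" "((1, e k), (2, k)) \<in> r" if "k < ?n" for k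
    using rQ[of "(True, k)" "(False, e k)"] rQ[of "(False, e k)" "(True, k)"] that
      eb[OF that] llo[OF that] lup[of "e k"] by auto
  have cc: "((1, c), (1, c + 1)) \<in> r" "((1, c + 1), (1, c)) \<in> r"
    using rQ[of "(False, c)" "(False, c + 1)"] rQ[of "(False, c + 1)" "(False, c)"]
      lup[of c] lup[of "c + 1"] by (auto simp: c_def)
  have sound1: "Phi x = Phi y" if "(x, y) \<in> r" for x y
    using that unfolding r_def comp_rel_lpart
  proof
    assume "\<exists>s\<in>pts (length []) (length ?ms). \<exists>t\<in>pts (length []) (length ?ms).
      lab [] ?ms s = lab [] ?ms t \<and> x = layP s \<and> y = layP t"
    then obtain s t where st: "s \<in> pts 0 (?n + 2)" "t \<in> pts 0 (?n + 2)" "lab [] ?ms s = lab [] ?ms t"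
      "x = layP s" "y = layP t" by auto
    then obtain k k' where "s = (True, k)" "t = (True, k')" by (auto simp: pts_def)
    then show ?thesis using st by (simp add: Phi_def)
  next
    assume "\<exists>s\<in>pts (length (U @ [(a, c), (a, c)] @ V)) (length (U @ V)).
      \<exists>t\<in>pts (length (U @ [(a, c), (a, c)] @ V)) (length (U @ V)).
        lab (U @ [(a, c), (a, c)] @ V) (U @ V) s = lab (U @ [(a, c), (a, c)] @ V) (U @ V) t \<and>
        x = layQ s \<and> y = layQ t"
    then obtain s t where st: "s \<in> pts (?n + 2) ?n" "t \<in> pts (?n + 2) ?n"
      and eq: "lab (U @ [(a, c), (a, c)] @ V) (U @ V) s = lab (U @ [(a, c), (a, c)] @ V) (U @ V) t"
      and xy: "x = layQ s" "y = layQ t" by (auto simp: len c_def)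
    \<comment> \<open>In the lower factor \<open>Phi\<close> depends only on the label of a point;
      at the cap this holds because \<open>?m\<close> sends \<open>i\<close> and \<open>j\<close> to
      the same label.\<close>
    have key: "Phi (layQ s) = ?m (snd (?ms ! (lab (U @ [(a, c), (a, c)] @ V) (U @ V) s)))"
      if "s \<in> pts (?n + 2) ?n" for s
    proof (cases s)
      case (Pair b k)
      show ?thesis
      proof (cases b)
        case True
        then show ?thesis using that Pair llo[of k] ems[of k] by (simp add: Phi_def del: lab.simps)
      next
        case False
        then show ?thesis using that Pair lup[of k] msc by (auto simp add: Phi_def simp del: lab.simps)
      qed
    qed
    show ?thesis using key[OF st(1)] key[OF st(2)] eq xy by simp
  qed
  have sound: "Phi x = Phi y" if "(x, y) \<in> r\<^sup>*" for x y
    using that by (induction rule: rtrancl_induct) (use sound1 in auto)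
  \<comment> \<open>Conversely, points with equal merged label are either joined in the middle row
    already, or carry \<open>i\<close> and \<open>j\<close> and are joined through the cap.\<close>
  have compl: "((2, k), (2, k')) \<in> r\<^sup>*"
    if k: "k < ?n" "k' < ?n" and eq: "?m (snd ((u @ v) ! k)) = ?m (snd ((u @ v) ! k'))" for k k'
  proof -
    have "((1, e k), (1, e k')) \<in> r\<^sup>*"
    proof (cases "snd ((u @ v) ! k) = snd ((u @ v) ! k')")
      case True
      then show ?thesis using rP[of "e k" "e k'"] eb k ems by auto
    next
      case False
      then consider "snd ((u @ v) ! k) = i" "snd ((u @ v) ! k') = j"
        | "snd ((u @ v) ! k) = j" "snd ((u @ v) ! k') = i"
        using eq by (auto split: if_splits)
      then show ?thesis
      proof cases
        case 1
        then have "((1, e k), (1, c)) \<in> r" "((1, c + 1), (1, e k')) \<in> r"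
          using rP[of "e k" c] rP[of "c + 1" "e k'"] eb k ems msc by (auto simp: c_def)
        then show ?thesis using cc(1) by (meson r_into_rtrancl rtrancl.rtrancl_into_rtrancl)
      next
        case 2
        then have "((1, e k), (1, c + 1)) \<in> r" "((1, c), (1, e k')) \<in> r"
          using rP[of "e k" "c + 1"] rP[of c "e k'"] eb k ems msc by (auto simp: c_def)
        then show ?thesis using cc(2) by (meson r_into_rtrancl rtrancl.rtrancl_into_rtrancl)
      qed
    qed
    then show ?thesis using down k
      by (meson converse_rtrancl_into_rtrancl rtrancl.rtrancl_into_rtrancl)
  qed
  have iff: "(outer t, outer s) \<in> r\<^sup>* \<longleftrightarrow> lab [] (relabel ?m (u @ v)) s = lab [] (relabel ?m (u @ v)) t"
    if st: "s \<in> pts 0 ?n" "t \<in> pts 0 ?n" for s t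
  proof -
    obtain k k' where k: "s = (True, k)" "t = (True, k')" "k < ?n" "k' < ?n"
      using st by (auto simp: pts_def)
    have "lab [] (relabel ?m (u @ v)) (True, k) = ?m (snd ((u @ v) ! k))" if "k < ?n" for k
      using that by (simp del: map_append)
    then show ?thesis using compl[of k' k] sound[of "(2, k')" "(2, k)"] k
      by (auto simp: Phi_def simp del: lab.simps map_append)
  qed
  have pe: "points (map fst ([]::lword)) (map fst (U @ V)) = pts 0 ?n"
    by (simp add: points_pts len c_def)
  have "{{s \<in> pts 0 ?n. (outer t, outer s) \<in> r\<^sup>*} |t. t \<in> pts 0 ?n} = kerp (pts 0 ?n) (lab [] (relabel ?m (u @ v)))"
    by (rule comp_eq_kerp) (rule iff)
  then show ?thesis unfolding comp_def lpart_sel pe r_def[symmetric]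
    by (simp add: lpart_def len comp_def)
qed

lemma relabel_ident [simp]: "relabel (\<lambda>k. k) xs = xs"
  by (induction xs) auto

lemma relabel_relabel: "relabel f (relabel g xs) = relabel (\<lambda>k. f (g k)) xs"
  by (induction xs) auto

lemma relabel_fresh: "M \<notin> labs xs \<Longrightarrow> relabel (mrg i M) xs = xs"
  by (induction xs) auto

lemma labs_relabel: "labs (relabel f xs) = f ` labs xs"
  by (auto simp: image_image)

lemma lpart_relabel:
  assumes "inj_on f (labs us \<union> labs ls)"
  shows "lpart (relabel f us) (relabel f ls) = lpart us ls"
proof -
  let ?A = "pts (length us) (length ls)"
  have 1: "lab (relabel f us) (relabel f ls) t = f (lab us ls t)" if "t \<in> ?A" for t
    using that by (cases t; cases "fst t") auto
  have 2: "lab us ls t \<in> labs us \<union> labs ls" if "t \<in> ?A" for t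
    using that by (cases t; cases "fst t") auto
  have "kerp ?A (lab (relabel f us) (relabel f ls)) = kerp ?A (lab us ls)"
    using assms by (intro kerp_cong) (metis 1 2 inj_onD)
  then show ?thesis by (simp add: lpart_def)
qed

section \<open>Closure properties of the one-row words of a category\<close>

definition lwords :: "part set \<Rightarrow> lword set" where
  "lwords C = {xs. lpart [] xs \<in> C}"

abbreviation lbl :: "nat \<Rightarrow> col list \<Rightarrow> lword" where
  "lbl k w \<equiv> map (\<lambda>c. (c, k)) w"

lemma labs_lbl: "labs (lbl k w) = (if w = [] then {} else {k})"
  by (cases w) (auto simp: image_image)

lemma lbl_map_fst: "labs xs \<subseteq> {l} \<Longrightarrow> lbl l (map fst xs) = xs"
  by (induction xs) auto

lemma fresh_label: "\<exists>M::nat. \<forall>k\<in>labs xs. k < M"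
  using finite_nat_set_iff_bounded[of "labs xs"] by auto

locale category =
  fixes C :: "part set"
  assumes is_cat: "is_category C"
begin

abbreviation R :: "lword set" where "R \<equiv> lwords C"

lemma cat_rules:
  "p \<in> C \<Longrightarrow> noncrossing p"
  "p \<in> C \<Longrightarrow> q \<in> C \<Longrightarrow> tensor p q \<in> C"
  "p \<in> C \<Longrightarrow> q \<in> C \<Longrightarrow> lo p = up q \<Longrightarrow> comp q p \<in> C"
  "p \<in> C \<Longrightarrow> adj p \<in> C"
  "p \<in> C \<Longrightarrow> up p \<noteq> [] \<Longrightarrow> rotUL p \<in> C"
  "p \<in> C \<Longrightarrow> lo p \<noteq> [] \<Longrightarrow> rotLU p \<in> C"
  "p \<in> C \<Longrightarrow> up p \<noteq> [] \<Longrightarrow> rotUR p \<in> C"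
  "p \<in> C \<Longrightarrow> lo p \<noteq> [] \<Longrightarrow> rotLR p \<in> C"
  "pi_part [a] [a] \<in> C"
  using is_cat unfolding is_category_def by blast+

text \<open>Right rotations bring the upper row down letter by letter from its right end, so it
  arrives reversed.\<close>

lemma lpart_in_iff: "lpart us ls \<in> C \<longleftrightarrow> ls @ rev us \<in> R"
proof (induction us arbitrary: ls rule: rev_induct)
  case (snoc x us)
  have "lpart (us @ [x]) ls \<in> C \<longleftrightarrow> lpart us (ls @ [x]) \<in> C"
    using cat_rules(7)[of "lpart (us @ [x]) ls"] cat_rules(8)[of "lpart us (ls @ [x])"]
    by (auto simp: rotUR_lpart rotLR_lpart)
  then show ?case using snoc by simp
qed (simp add: lwords_def)

lemma in_cat_lpart:
  assumes "p \<in> C" obtains us ls where "p = lpart us ls" "ls @ rev us \<in> R"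
  using assms cat_rules(1) wf_part_lpart lpart_in_iff unfolding noncrossing_def by metis

text \<open>Lifting the first letter at the left end and lowering it at the right end is a cyclic
  shift.\<close>

lemma R_rotate1: "x # xs \<in> R \<Longrightarrow> xs @ [x] \<in> R"
proof -
  assume "x # xs \<in> R"
  then have "lpart [] (x # xs) \<in> C" by (simp add: lwords_def)
  then have "lpart [x] xs \<in> C" using cat_rules(6) rotLU_lpart[of "[]" x xs] by fastforce
  then show ?thesis by (simp add: lpart_in_iff)
qed

lemma R_rotate: "u @ v \<in> R \<Longrightarrow> v @ u \<in> R"
proof (induction u arbitrary: v)
  case (Cons x u)
  then have "u @ (v @ [x]) \<in> R" using R_rotate1[of x "u @ v"] by simp
  from Cons.IH[OF this] show ?case by simp
qed simp

lemma R_append: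
  assumes "xs \<in> R" "ys \<in> R" "labs xs \<inter> labs ys = {}" shows "xs @ ys \<in> R"
  using assms cat_rules(2)[of "lpart [] xs" "lpart [] ys"] tensor_lpart[of "[]" xs "[]" ys]
  by (auto simp: lwords_def)

text \<open>Rotation moves the place of insertion to the end of the word, where the tensor product
  applies.\<close>

lemma R_insert:
  assumes "u @ v \<in> R" "z \<in> R" "labs z \<inter> labs (u @ v) = {}" shows "u @ z @ v \<in> R"
proof -
  have "labs (v @ u) \<inter> labs z = {}" using assms(3) by auto
  from R_append[OF R_rotate[OF assms(1)] assms(2) this]
  have "(v @ u) @ z \<in> R" .
  then show ?thesis using R_rotate[of v "u @ z"] by simp
qed

text \<open>The adjoint moves the row to the top, and rotating it down again reverses it.\<close>

lemma R_rev: "xs \<in> R \<Longrightarrow> rev xs \<in> R"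
  using cat_rules(4)[of "lpart [] xs"] lpart_in_iff[of xs "[]"] by (simp add: adj_lpart lwords_def)

lemma R_relabel_iff: "inj_on f (labs xs) \<Longrightarrow> relabel f xs \<in> R \<longleftrightarrow> xs \<in> R"
  using lpart_relabel[of f "[]" xs] by (simp add: lwords_def)

lemma lpart_id1: "lpart [(a, k)] [(a, k)] \<in> C"
proof -
  have "kerp (pts 1 1) (lab [(a, k)] [(a, k)]) = {pts 1 1}"
    by (auto simp: kerp_def pts_def image_def)
  moreover have "(False, 0) \<in> pts 1 1" by simp
  then have "{pts 1 1} - {{}} = {pts 1 1}" by blast
  ultimately have "lpart [(a, k)] [(a, k)] = pi_part [a] [a]"
    by (simp add: lpart_def pi_part_def points_pts)
  then show ?thesis using cat_rules(9) by simp
qed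

lemma R_pair: "[(a, k), (a, k)] \<in> R"
  using lpart_id1[of a k] by (simp add: lpart_in_iff)

lemma lpart_idl: "lpart (idl s w) (idl s w) \<in> C"
proof (induction w arbitrary: s)
  case Nil
  \<comment> \<open>The empty partition arises by closing a pair with a cap, which leaves no outer
    points.\<close>
  have "comp (lpart [(X, 0), (X, 0)] []) (lpart [] [(X, 0), (X, 0)]) \<in> C"
    using lpart_id1[of X 0] R_pair[of X 0] by (intro cat_rules(3)) (simp_all add: lpart_in_iff)
  then show ?case using comp_cap[of "[]" X "[]" 0 0] by (simp add: idl_def)
next
  case (Cons a w)
  have e: "idl s (a # w) = [(a, s)] @ idl (Suc s) w" by (simp add: idl_Cons)
  have "labs (idl (Suc s) w) \<subseteq> {Suc s..}" using labs_idl[of "Suc s" w] by auto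
  then have "tensor (lpart [(a, s)] [(a, s)]) (lpart (idl (Suc s) w) (idl (Suc s) w))
      = lpart (idl s (a # w)) (idl s (a # w))"
    unfolding e by (intro tensor_lpart) auto
  then show ?case using cat_rules(2)[OF lpart_id1 Cons] by metis
qed

lemma R_cap:
  assumes "u @ [(a, i), (a, j)] @ v \<in> R" shows "relabel (mrg i j) (u @ v) \<in> R"
proof -
  define c where "c = length u"
  define U where "U = idl 0 (map fst u)"
  define V where "V = idl (c + 2) (map fst v)"
  have lU: "labs U \<subseteq> {..<c}" and lV: "labs V \<subseteq> {c + 2..}"
    using labs_idl[of 0 "map fst u"] labs_idl[of "c + 2" "map fst v"]
    by (auto simp: U_def V_def c_def)
  have cap: "lpart [(a, c), (a, c)] [] \<in> C" using R_pair[of a c] by (simp add: lpart_in_iff)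
  have "(labs [(a, c), (a, c)] \<union> labs []) \<inter> (labs V \<union> labs V) = {}" using lV by auto
  from tensor_lpart[OF this] have 1: "lpart ([(a, c), (a, c)] @ V) V \<in> C"
    using cat_rules(2)[OF cap lpart_idl[of "c + 2" "map fst v"]] by (simp add: V_def)
  have "x \<notin> labs V" if "x \<in> labs U" for x using lU lV that by fastforce
  then have "(labs U \<union> labs U) \<inter> (labs ([(a, c), (a, c)] @ V) \<union> labs V) = {}"
    using lU by auto
  then have q: "lpart (U @ [(a, c), (a, c)] @ V) (U @ V) \<in> C"
    using cat_rules(2)[OF lpart_idl[of 0 "map fst u"] 1] tensor_lpart[of U U "[(a, c), (a, c)] @ V" V]
    by (simp add: U_def)
  have "comp (lpart (U @ [(a, c), (a, c)] @ V) (U @ V)) (lpart [] (u @ [(a, i), (a, j)] @ v)) \<in> C"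
    using q assms by (intro cat_rules(3)) (simp_all add: lwords_def U_def V_def)
  then show ?thesis using comp_cap[of u a v i j] by (simp add: lwords_def U_def V_def c_def)
qed

lemma R_cap_same: "u @ [(a, i), (a, i)] @ v \<in> R \<Longrightarrow> u @ v \<in> R"
  using R_cap[of u a i i v] by (simp add: map_idI apsnd_def map_prod_def split_beta)

lemma R_Nil: "[] \<in> R"
  using R_cap_same[of "[]" X 0 "[]"] R_pair by simp

text \<open>The facing letters of \<open>s\<close> and \<open>t\<close> are capped from the inside
  out. The function \<open>f\<close> composes all the mergings: it moves only labels of
  \<open>s\<close> and \<open>t\<close>, and it identifies the labels of facing letters.\<close>

lemma R_cap_many:
  assumes "u @ s @ t @ v \<in> R" "map fst t = rev (map fst s)"
  shows "\<exists>f. relabel f (u @ v) \<in> R \<and> (\<forall>k. k \<notin> labs s \<union> labs t \<longrightarrow> f k = k) \<and>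
    (\<forall>k \<in> labs s \<union> labs t. f k \<in> labs s \<union> labs t) \<and>
    map (f \<circ> snd) t = rev (map (f \<circ> snd) s)"
  using assms
proof (induction "length s" arbitrary: s u t v)
  case 0
  then show ?case by (intro exI[of _ "\<lambda>k. k"]) auto
next
  case (Suc n ss)
  obtain s x where ss: "ss = s @ [x]" using Suc.hyps(2) by (cases ss rule: rev_cases) auto
  obtain y t' where t: "t = y # t'" using Suc.prems(2) ss by (cases t) auto
  obtain a i j where x: "x = (a, i)" and y: "y = (a, j)"
    using Suc.prems(2) t ss by (cases x; cases y) auto
  let ?m = "mrg i j"
  define L where "L = labs ss \<union> labs t"
  define L' where "L' = labs (relabel ?m s) \<union> labs (relabel ?m t')"
  have "(u @ s) @ [(a, i), (a, j)] @ (t' @ v) \<in> R" using Suc.prems(1) t x y ss by simp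
  from R_cap[OF this]
  have "relabel ?m u @ relabel ?m s @ relabel ?m t' @ relabel ?m v \<in> R" by simp
  moreover have "map fst (relabel ?m t') = rev (map fst (relabel ?m s))"
    using Suc.prems(2) t ss by (simp add: o_def)
  moreover have "n = length (relabel ?m s)" using Suc.hyps(2) ss by simp
  ultimately have "\<exists>f. relabel f (relabel ?m u @ relabel ?m v) \<in> R \<and>
    (\<forall>k. k \<notin> labs (relabel ?m s) \<union> labs (relabel ?m t') \<longrightarrow> f k = k) \<and>
    (\<forall>k \<in> labs (relabel ?m s) \<union> labs (relabel ?m t'). f k \<in> labs (relabel ?m s) \<union> labs (relabel ?m t')) \<and>
    map (f \<circ> snd) (relabel ?m t') = rev (map (f \<circ> snd) (relabel ?m s))"
    by (intro Suc.hyps(1))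
  then obtain f where f: "relabel f (relabel ?m u @ relabel ?m v) \<in> R"
    "\<And>k. k \<notin> L' \<Longrightarrow> f k = k" "\<And>k. k \<in> L' \<Longrightarrow> f k \<in> L'"
    "map (f \<circ> snd) (relabel ?m t') = rev (map (f \<circ> snd) (relabel ?m s))"
    unfolding L'_def[symmetric] by blast
  have "?m ` labs s \<subseteq> insert i (labs s)" "?m ` labs t' \<subseteq> insert i (labs t')" by auto
  then have sub: "L' \<subseteq> L" unfolding L_def L'_def labs_relabel ss t x by auto
  have mL: "?m k \<in> L" if "k \<in> L" for k using that by (simp add: x ss L_def)
  have nj: "k \<noteq> j" if "k \<notin> L" for k using that by (auto simp: L_def y t)
  have "relabel (\<lambda>k. f (?m k)) (u @ v) \<in> R"
    using f(1) unfolding map_append relabel_relabel .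
  moreover have "f (?m k) = k" if "k \<notin> L" for k
  proof -
    have "f k = k" using f(2) sub that by blast
    then show ?thesis using nj[OF that] by simp
  qed
  moreover have "f (?m k) \<in> L" if "k \<in> L" for k
  proof (cases "?m k \<in> L'")
    case True
    show ?thesis using f(3)[OF True] sub by (rule rev_subsetD)
  next
    case False
    show ?thesis using mL[OF that] by (simp only: f(2)[OF False])
  qed
  moreover have "map ((\<lambda>k. f (?m k)) \<circ> snd) t = rev (map ((\<lambda>k. f (?m k)) \<circ> snd) ss)"
    using f(4) by (simp add: t x y ss o_def)
  ultimately show ?case unfolding L_def[symmetric] by (intro exI[of _ "\<lambda>k. f (?m k)"]) simp
qed

lemma R_cancel_same: "u @ lbl i w @ rev (lbl i w) @ v \<in> R \<Longrightarrow> u @ v \<in> R"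
proof (induction w arbitrary: u v rule: rev_induct)
  case (snoc a w)
  then show ?case using R_cap_same[of "u @ lbl i w" a i "rev (lbl i w) @ v"] by simp
qed simp

text \<open>The innermost cap already merges \<open>j\<close> into \<open>i\<close>; every later cap
  closes two letters with the same label.\<close>

lemma R_cancel:
  assumes "u @ lbl i w @ rev (lbl j w) @ v \<in> R" "w \<noteq> []"
  shows "relabel (mrg i j) (u @ v) \<in> R"
proof -
  obtain w' a where w: "w = w' @ [a]" using assms(2) by (metis rev_exhaust)
  have "relabel (mrg i j) ((u @ lbl i w') @ (rev (lbl j w') @ v)) \<in> R"
  proof (rule R_cap)
    show "(u @ lbl i w') @ [(a, i), (a, j)] @ rev (lbl j w') @ v \<in> R"
      using assms(1) by (simp add: w)
  qed
  moreover have "relabel (mrg i j) (lbl i w') = lbl i w'" "relabel (mrg i j) (rev (lbl j w')) = rev (lbl i w')"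
    by (induction w') auto
  ultimately have "relabel (mrg i j) u @ lbl i w' @ rev (lbl i w') @ relabel (mrg i j) v \<in> R"
    by (simp only: map_append append_assoc)
  from R_cancel_same[OF this] show ?thesis by (simp only: map_append)
qed

text \<open>The word form of composing a partition with its adjoint along \<open>r\<close>. Blocks
  of \<open>p\<close> that reach \<open>r\<close> are connected through it to the mirror copy, so
  \<open>f\<close> and \<open>g\<close> agree on them; a block of \<open>p\<close> avoiding
  \<open>r\<close> stays apart from the whole mirror copy.\<close>

lemma R_rank:
  assumes "p @ r \<in> R"
  shows "\<exists>f g. relabel f p @ rev (relabel g p) \<in> R \<and> (\<forall>k\<in>labs r. f k = g k) \<and>
    (\<forall>k\<in>labs p - labs r. \<forall>l\<in>labs p. f k \<noteq> g l)"
proof -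
  obtain M where M: "\<forall>k\<in>labs (p @ r). k < M" using fresh_label by blast
  \<comment> \<open>Shifting by a bound \<open>M\<close> of all labels makes the mirror copy
    disjoint from the original, so that the two can be juxtaposed.\<close>
  let ?s = "\<lambda>k. k + M"
  have "relabel ?s (p @ r) \<in> R" using assms by (subst R_relabel_iff) (auto simp: inj_on_def)
  from R_rev[OF this] have "rev (relabel ?s r) @ rev (relabel ?s p) \<in> R" by (simp add: rev_map)
  moreover have "labs (rev (relabel ?s r) @ rev (relabel ?s p)) = ?s ` labs (p @ r)"
    by (auto simp: image_Un image_image)
  moreover have "A \<inter> ?s ` A = {}" if "\<forall>k\<in>A. k < M" for A
    using that by auto
  from this[OF M] have "labs (p @ r) \<inter> ?s ` labs (p @ r) = {}" .
  ultimately have "(p @ r) @ (rev (relabel ?s r) @ rev (relabel ?s p)) \<in> R"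
    using R_append[OF assms] by (simp only:)
  then have "p @ r @ rev (relabel ?s r) @ rev (relabel ?s p) \<in> R" by simp
  moreover have "map fst (rev (relabel ?s r)) = rev (map fst r)" by (simp add: rev_map o_def)
  moreover have ll: "labs r \<union> labs (rev (relabel ?s r)) = labs r \<union> ?s ` labs r" by force
  ultimately obtain f where f: "relabel f (p @ rev (relabel ?s p)) \<in> R"
    "\<forall>k. k \<notin> labs r \<union> ?s ` labs r \<longrightarrow> f k = k"
    "\<forall>k \<in> labs r \<union> ?s ` labs r. f k \<in> labs r \<union> ?s ` labs r"
    "map (f \<circ> snd) (rev (relabel ?s r)) = rev (map (f \<circ> snd) r)"
    using R_cap_many[of p r "rev (relabel ?s r)" "rev (relabel ?s p)"] unfolding ll by blast
  let ?g = "\<lambda>k. f (k + M)"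
  have "relabel f p @ rev (relabel ?g p) \<in> R"
    using f(1) unfolding map_append rev_map[symmetric] relabel_relabel by (simp only: o_def)
  moreover have "\<forall>k\<in>labs r. f k = ?g k"
    using f(4) by (auto simp: rev_map[symmetric] o_def)
  moreover have "f k \<noteq> ?g l" if k: "k \<in> labs p - labs r" and l: "l \<in> labs p" for k l
  proof -
    have kM: "k < M" using M k by auto
    have nk: "k \<notin> labs r \<union> ?s ` labs r" using k kM by auto
    then have fk: "f k = k" using f(2) by blast
    show ?thesis
    proof (cases "l \<in> labs r")
      case True
      then have "?g l \<in> labs r \<union> ?s ` labs r" using f(3) by blast
      then show ?thesis using fk nk by auto
    next
      case False
      moreover have "l + M \<in> ?s ` labs r \<longleftrightarrow> l \<in> labs r"
        using inj_image_mem_iff[of ?s l "labs r"] by (simp add: inj_def)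
      moreover have "l + M \<notin> labs r" using M by fastforce
      ultimately have "l + M \<notin> labs r \<union> ?s ` labs r" by blast
      then have "?g l = l + M" using f(2) by blast
      then show ?thesis using fk kM by auto
    qed
  qed
  ultimately show ?thesis by blast
qed

lemma R_lbl_iff: "lbl i w \<in> R \<longleftrightarrow> lbl j w \<in> R"
  using R_relabel_iff[of "\<lambda>_. i" "lbl j w"] by (auto simp: inj_on_def o_def)

lemma R_lbl2_iff:
  assumes "i \<noteq> j" "i' \<noteq> j'"
  shows "lbl i w @ rev (lbl j w') \<in> R \<longleftrightarrow> lbl i' w @ rev (lbl j' w') \<in> R"
proof -
  let ?f = "\<lambda>k. if k = i' then i else j"
  have "relabel ?f (lbl i' w @ rev (lbl j' w')) = lbl i w @ rev (lbl j w')"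
    using assms by (simp add: rev_map o_def)
  moreover have "inj_on ?f (labs (lbl i' w @ rev (lbl j' w')))"
    using assms by (auto simp: inj_on_def)
  ultimately show ?thesis using R_relabel_iff by metis
qed

text \<open>The block of \<open>p\<close> continues into \<open>r\<close>, so composing with the
  adjoint along \<open>r\<close> joins \<open>p\<close> to its mirror image.\<close>

lemma R_double:
  assumes "p @ r \<in> R" "labs p \<subseteq> {l}" "l \<in> labs r"
  shows "lbl 0 (map fst p @ rev (map fst p)) \<in> R"
proof -
  obtain f g where fg: "relabel f p @ rev (relabel g p) \<in> R" "f l = g l"
    using R_rank[OF assms(1)] assms(3) by blast
  have p: "p = lbl l (map fst p)" using assms(2) lbl_map_fst by metis
  have "relabel f p = lbl (f l) (map fst p)" "relabel g p = lbl (f l) (map fst p)"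
    by (subst p, simp add: o_def fg)+
  then have "lbl (f l) (map fst p @ rev (map fst p)) \<in> R" using fg(1) by (simp only: map_append rev_map)
  then show ?thesis using R_lbl_iff by blast
qed

text \<open>A block lying entirely in \<open>p\<close> is not connected to its mirror image. The
  conclusion is the one-row form of \<open>beta(w,w)\<close> for the colour word \<open>w\<close> of
  \<open>p\<close>.\<close>

lemma R_beta:
  assumes "p @ r \<in> R" "labs p \<subseteq> {l}" "l \<notin> labs r"
  shows "lbl 0 (map fst p) @ rev (lbl 1 (map fst p)) \<in> R"
proof (cases "p = []")
  case False
  then have "labs p = {l}" using assms(2) by (cases p) auto
  then obtain f g where fg: "relabel f p @ rev (relabel g p) \<in> R" "f l \<noteq> g l"
    using R_rank[OF assms(1)] assms(3) by (metis Diff_iff singletonI)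
  have p: "p = lbl l (map fst p)" using assms(2) lbl_map_fst by metis
  have "relabel f p = lbl (f l) (map fst p)" "relabel g p = lbl (g l) (map fst p)"
    by (subst p, simp add: o_def)+
  then have "lbl (f l) (map fst p) @ rev (lbl (g l) (map fst p)) \<in> R" using fg(1) by (simp only:)
  then show ?thesis using R_lbl2_iff[OF fg(2), of 0 1] by (simp del: map_map)
qed (simp add: R_Nil)

end

section \<open>Interval blocks and mixed blocks\<close>

definition ncl :: "lword \<Rightarrow> bool" where
  "ncl xs \<longleftrightarrow> (\<forall>i j k l. i < j \<longrightarrow> j < k \<longrightarrow> k < l \<longrightarrow> l < length xs \<longrightarrow>
     snd (xs ! i) = snd (xs ! k) \<longrightarrow> snd (xs ! j) = snd (xs ! l) \<longrightarrow> snd (xs ! i) = snd (xs ! j))"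

lemma nclD:
  "ncl xs \<Longrightarrow> i < j \<Longrightarrow> j < k \<Longrightarrow> k < l \<Longrightarrow> l < length xs \<Longrightarrow> snd (xs ! i) = snd (xs ! k) \<Longrightarrow>
     snd (xs ! j) = snd (xs ! l) \<Longrightarrow> snd (xs ! i) = snd (xs ! j)"
  unfolding ncl_def by blast

text \<open>The order of points given by \<open>pos\<close>, read backwards, is the order of letters
  in \<open>ls @ rev us\<close>, and reversing the order preserves crossings.\<close>

lemma noncrossing_lpart:
  assumes "noncrossing (lpart us ls)" shows "ncl (ls @ rev us)"
  unfolding ncl_def
proof (intro allI impI)
  fix i j k l
  let ?p = "lpart us ls" and ?xs = "ls @ rev us" and ?A = "pts (length us) (length ls)"
  assume ijkl: "i < j" "j < k" "k < l" "l < length ?xs"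
    and eq: "snd (?xs ! i) = snd (?xs ! k)" "snd (?xs ! j) = snd (?xs ! l)"
  \<comment> \<open>The point at position \<open>q\<close> of the word; \<open>pos\<close> counts it
    from the other end.\<close>
  define P where "P q = (if q < length ls then (True, q) else (False, length us + length ls - 1 - q))" for q
  have PA: "P q \<in> ?A" and Plab: "lab us ls (P q) = snd (?xs ! q)"
    and Ppos: "pos ?p (P q) = length us + length ls - 1 - q" if "q < length ?xs" for q
    using that by (auto simp: P_def nth_append rev_nth algebra_simps)
  show "snd (?xs ! i) = snd (?xs ! j)"
  proof (rule ccontr)
    assume ne: "snd (?xs ! i) \<noteq> snd (?xs ! j)"
    define B1 where "B1 = {s \<in> ?A. lab us ls s = lab us ls (P j)}"
    define B2 where "B2 = {s \<in> ?A. lab us ls s = lab us ls (P i)}"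
    have "B1 \<in> blocks ?p" "B2 \<in> blocks ?p"
      using ijkl PA by (auto simp: B1_def B2_def kerp_def)
    moreover have mem: "P l \<in> B1" "P j \<in> B1" "P k \<in> B2" "P i \<in> B2"
      using ijkl PA Plab eq by (auto simp: B1_def B2_def)
    moreover have "B1 \<noteq> B2" using mem(2) ne Plab ijkl by (auto simp: B2_def)
    moreover have "pos ?p (P l) < pos ?p (P k)" "pos ?p (P k) < pos ?p (P j)" "pos ?p (P j) < pos ?p (P i)"
      using Ppos ijkl by auto
    ultimately have "\<exists>B1\<in>blocks ?p. \<exists>B2\<in>blocks ?p. B1 \<noteq> B2 \<and>
          (\<exists>a b c e. a \<in> B1 \<and> c \<in> B1 \<and> b \<in> B2 \<and> e \<in> B2 \<and>
             pos ?p a < pos ?p b \<and> pos ?p b < pos ?p c \<and> pos ?p c < pos ?p e)"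
      by (intro bexI[of _ B1] bexI[of _ B2] exI[of _ "P l"] exI[of _ "P k"] exI[of _ "P j"] exI[of _ "P i"] conjI)
    then show False using assms unfolding noncrossing_def by (elim conjE) (rule notE)
  qed
qed

lemma ncl_remove:
  assumes "ncl (u @ b @ v)" shows "ncl (u @ v)"
  unfolding ncl_def
proof (intro allI impI)
  fix i j k l
  assume a: "i < j" "j < k" "k < l" "l < length (u @ v)"
    "snd ((u @ v) ! i) = snd ((u @ v) ! k)" "snd ((u @ v) ! j) = snd ((u @ v) ! l)"
  define e where "e q = (if q < length u then q else q + length b)" for q
  have e: "(u @ b @ v) ! e q = (u @ v) ! q" for q by (auto simp: e_def nth_append)
  have "e i < e j" "e j < e k" "e k < e l" "e l < length (u @ b @ v)" using a by (auto simp: e_def)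
  from nclD[OF assms this] a(5,6) e show "snd ((u @ v) ! i) = snd ((u @ v) ! j)" by simp
qed

text \<open>Among the labels satisfying \<open>P\<close>, one of minimal span occupies an interval:
  a foreign label met inside would, by noncrossing, lie strictly inside and have smaller span. The
  hypothesis \<open>closed\<close> ensures that this foreign label satisfies \<open>P\<close>
  too.\<close>

lemma interval_block:
  assumes nc: "ncl xs" and i0: "i0 < length xs" "P (snd (xs ! i0))"
    and closed: "\<And>i j k. i < j \<Longrightarrow> j < k \<Longrightarrow> k < length xs \<Longrightarrow> snd (xs ! i) = snd (xs ! k) \<Longrightarrow>
      P (snd (xs ! i)) \<Longrightarrow> P (snd (xs ! j))"
  obtains u b v l where "xs = u @ b @ v" "b \<noteq> []" "labs b \<subseteq> {l}" "P l" "l \<notin> labs (u @ v)"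
proof -
  define s where "s i = snd (xs ! i)" for i
  define n where "n = length xs"
  define D where "D l = {i. i < n \<and> s i = l}" for l
  have fin: "finite (D l)" for l by (simp add: D_def)
  define F where "F l = Min (D l)" for l
  define La where "La l = Max (D l)" for l
  have FL: "F (s i) \<le> i" "i \<le> La (s i)" "F (s i) \<in> D (s i)" "La (s i) \<in> D (s i)" if "i < n" for i
  proof -
    have i: "i \<in> D (s i)" using that by (simp add: D_def)
    then have "D (s i) \<noteq> {}" by blast
    with i show "F (s i) \<le> i" "i \<le> La (s i)" "F (s i) \<in> D (s i)" "La (s i) \<in> D (s i)"
      unfolding F_def La_def using fin[of "s i"] by simp_all
  qed
  define Q where "Q l \<longleftrightarrow> (\<exists>i<n. s i = l) \<and> P l" for l
  have "Q (s i0)" using i0 by (auto simp: Q_def n_def s_def)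
  then obtain l where l: "Q l" "\<And>l'. Q l' \<Longrightarrow> La l - F l \<le> La l' - F l'"
    using ex_has_least_nat[of Q _ "\<lambda>l. La l - F l"] by blast
  obtain i where i: "i < n" "s i = l" using l(1) by (auto simp: Q_def)
  have Fl: "F l < n" "s (F l) = l" "F l \<le> i" and Ll: "La l < n" "s (La l) = l" "i \<le> La l"
    using FL[OF i(1)] i by (auto simp: D_def)
  have inside: "s j = l" if "F l \<le> j" "j \<le> La l" for j
  proof (rule ccontr)
    assume ne: "s j \<noteq> l"
    let ?k = "s j"
    have jn: "j < n" and jj: "F l < j" "j < La l"
      using that ne Fl Ll by (auto simp: order.order_iff_strict)
    have "Q ?k" using closed[OF jj, folded s_def n_def] l(1) Fl Ll jn by (auto simp: Q_def)
    have k: "F ?k < n" "s (F ?k) = ?k" "F ?k \<le> j" "La ?k < n" "s (La ?k) = ?k" "j \<le> La ?k"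
      using FL[OF jn] by (auto simp: D_def)
    \<comment> \<open>An occurrence of \<open>?k\<close> to the left of the block \<open>l\<close>
      would give the crossing pattern \<open>?k\<close>, \<open>l\<close>, \<open>?k\<close>,
      \<open>l\<close>.\<close>
    have "F l < F ?k"
    proof (rule ccontr)
      assume "\<not> F l < F ?k"
      then have "F ?k < F l" using k Fl ne by (metis linorder_neqE_nat)
      from nclD[OF nc this jj, folded s_def n_def] show False using k Fl Ll ne by simp
    qed
    moreover have "La ?k < La l"
    proof (rule ccontr)
      assume "\<not> La ?k < La l"
      then have "La l < La ?k" using k Ll ne by (metis linorder_neqE_nat)
      from nclD[OF nc jj this, folded s_def n_def] show False using k Fl Ll ne by simp
    qed
    ultimately show False using l(2)[OF \<open>Q ?k\<close>] k by linarith
  qed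
  have outside: "s j \<noteq> l" if "j < n" "j < F l \<or> La l < j" for j
    using FL(1,2)[OF that(1)] that(2) by auto
  define u where "u = take (F l) xs"
  define b where "b = take (Suc (La l) - F l) (drop (F l) xs)"
  define v where "v = drop (Suc (La l)) xs"
  have "F l \<le> La l" using Fl Ll by simp
  then have "drop (Suc (La l) - F l) (drop (F l) xs) = v"
    by (simp add: v_def)
  then have xs: "xs = u @ b @ v" unfolding u_def b_def by (metis append_take_drop_id)
  have lb: "length b = Suc (La l) - F l" using Fl Ll by (simp add: b_def n_def)
  then have "b \<noteq> []" using \<open>F l \<le> La l\<close> by auto
  moreover have "snd x = l" if "x \<in> set b" for x
  proof -
    obtain q where q: "q < length b" "x = b ! q" using \<open>x \<in> set b\<close> by (metis in_set_conv_nth)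
    then have "x = xs ! (F l + q)" using Fl by (simp add: b_def n_def)
    moreover have "F l + q \<le> La l" using q lb by simp
    ultimately show ?thesis using inside[of "F l + q"] by (simp add: s_def)
  qed
  then have "labs b \<subseteq> {l}" by auto
  moreover have "snd x \<noteq> l" if "x \<in> set u" for x
  proof -
    obtain q where q: "q < length u" "x = u ! q" using \<open>x \<in> set u\<close> by (metis in_set_conv_nth)
    then show ?thesis using outside[of q] Fl by (simp add: u_def s_def n_def)
  qed
  moreover have "snd x \<noteq> l" if "x \<in> set v" for x
  proof -
    obtain q where q: "q < length v" "x = v ! q" using \<open>x \<in> set v\<close> by (metis in_set_conv_nth)
    then show ?thesis using outside[of "Suc (La l) + q"] by (simp add: v_def s_def n_def)
  qed
  ultimately have "l \<notin> labs (u @ v)" by fastforce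
  then show ?thesis using that[OF xs \<open>b \<noteq> []\<close> \<open>labs b \<subseteq> {l}\<close>] l(1) by (simp add: Q_def)
qed

lemma interval_block_all:
  assumes "ncl xs" "xs \<noteq> []"
  obtains u b v l where "xs = u @ b @ v" "b \<noteq> []" "labs b \<subseteq> {l}" "l \<notin> labs (u @ v)"
  using interval_block[OF assms(1), of 0 "\<lambda>_. True"] assms(2) by (metis length_greater_0_conv)

abbreviation cnt :: "nat \<Rightarrow> lword \<Rightarrow> nat" where
  "cnt l xs \<equiv> length (filter (\<lambda>x. snd x = l) xs)"

lemma card_block:
  "card {s \<in> pts (length us) (length ls). lab us ls s = l} = cnt l us + cnt l ls"
proof -
  let ?U = "{i. i < length us \<and> snd (us ! i) = l}" and ?L = "{i. i < length ls \<and> snd (ls ! i) = l}"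
  have "{s \<in> pts (length us) (length ls). lab us ls s = l} = Pair False ` ?U \<union> Pair True ` ?L"
    by (auto simp: pts_def)
  moreover have "card (Pair False ` ?U \<union> Pair True ` ?L) = card ?U + card ?L"
    by (subst card_Un_disjoint) (auto simp: card_image inj_on_def)
  ultimately show ?thesis by (simp add: length_filter_conv_card)
qed

context category
begin

lemma R_ncl: "xs \<in> R \<Longrightarrow> ncl xs"
  using noncrossing_lpart[of "[]" xs] cat_rules(1) by (auto simp: lwords_def)

lemma R_lbl_rotate: "lbl 0 (u @ v) \<in> R \<Longrightarrow> lbl 0 (v @ u) \<in> R"
  using R_rotate[of "lbl 0 u" "lbl 0 v"] by simp

text \<open>Take the segment between two consecutive letters of the block, with a third one outside.
  Composing it with its adjoint gives a word whose first and last letters agree in colour and block;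
  rotated next to each other they form a pair whose block continues, and doubling this pair gives
  \<open>aaaa\<close>.\<close>

lemma four_block:
  assumes "p \<in> C" "B \<in> blocks p" "card B \<ge> 4"
  shows "\<exists>a. lbl 0 [a, a, a, a] \<in> R"
proof -
  obtain us ls where p: "p = lpart us ls" and R: "ls @ rev us \<in> R" using in_cat_lpart assms(1) by blast
  obtain l where "B = {s \<in> pts (length us) (length ls). lab us ls s = l}"
    using assms(2) by (auto simp: p kerp_def)
  then have c: "cnt l (ls @ rev us) \<ge> 4" using assms(3) card_block[of us ls l]
    by (simp add: rev_filter[symmetric])
  obtain x y z zs where xyz: "filter (\<lambda>x. snd x = l) (ls @ rev us) = x # y # z # zs"
  proof -
    have "\<exists>x y z zs. q = x # y # z # zs" if "length q \<ge> 4" for q :: lword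
      using that by (cases q rule: list.exhaust; cases "tl q"; cases "tl (tl q)") auto
    then show ?thesis using c that by blast
  qed
  obtain A V where A: "ls @ rev us = A @ x # V" "snd x = l" "y # z # zs = filter (\<lambda>x. snd x = l) V"
    using xyz unfolding filter_eq_Cons_iff by metis
  obtain V1 W where V: "V = V1 @ y # W" "snd y = l" "z # zs = filter (\<lambda>x. snd x = l) W"
    using A(3)[symmetric] unfolding filter_eq_Cons_iff by metis
  have lW: "l \<in> labs W"
  proof -
    have "z \<in> set (filter (\<lambda>x. snd x = l) W)" using V(3)[symmetric] by simp
    then show ?thesis by auto
  qed
  let ?p = "[x] @ V1 @ [y]"
  have "A @ (?p @ W) \<in> R" using R A(1) V(1) by simp
  then have "?p @ (W @ A) \<in> R" using R_rotate[of A "?p @ W"] by simp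
  then obtain f g where fg: "relabel f ?p @ rev (relabel g ?p) \<in> R" "f l = g l"
    using R_rank lW by (metis (no_types, lifting) UnCI image_Un set_append)
  let ?a = "fst x"
  have fx: "apsnd f x = (?a, f l)" "apsnd g x = (?a, f l)" "apsnd f y = (fst y, f l)"
    using A(2) V(2) fg(2) by (cases x; cases y; auto)+
  have "(([(?a, f l)] @ relabel f V1 @ [(fst y, f l)]) @ rev (relabel g (V1 @ [y]))) @ [(?a, f l)] \<in> R"
    using fg(1) by (simp add: fx)
  from R_rotate[OF this]
  have "[(?a, f l), (?a, f l)] @ (relabel f V1 @ [(fst y, f l)] @ rev (relabel g (V1 @ [y]))) \<in> R" by simp
  from R_double[OF this, of "f l"] show ?thesis by auto
qed

end

locale even_category = category +
  assumes even_blocks: "\<forall>p\<in>C. \<forall>B\<in>blocks p. even (card B)"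
begin

lemma R_even: "xs \<in> R \<Longrightarrow> even (cnt l xs)"
proof (cases "l \<in> labs xs")
  case True
  assume "xs \<in> R"
  then have C: "lpart [] xs \<in> C" by (simp add: lwords_def)
  obtain i where i: "i < length xs" "snd (xs ! i) = l" using True by (auto simp: in_set_conv_nth)
  then have "(True, i) \<in> pts 0 (length xs)" "lab [] xs (True, i) = l" by auto
  then have "{s \<in> pts 0 (length xs). lab [] xs s = l} \<in> blocks (lpart [] xs)"
    unfolding lpart_sel kerp_def list.size(3) by (intro image_eqI[of _ _ "(True, i)"]) (simp_all only:)
  then have "even (card {s \<in> pts 0 (length xs). lab [] xs s = l})" using even_blocks C by blast
  then show ?thesis using card_block[of "[]" xs l] by simp
next
  case False
  then have "filter (\<lambda>x. snd x = l) xs = []" by (auto simp: filter_empty_conv)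
  then show ?thesis by simp
qed

lemma even_interval:
  assumes "u @ b @ v \<in> R" "labs b \<subseteq> {l}" "l \<notin> labs (u @ v)"
  shows "even (length b)"
proof -
  have "filter (\<lambda>x. snd x = l) u = []" "filter (\<lambda>x. snd x = l) v = []"
    using assms(3) by (auto simp: filter_empty_conv)
  moreover have "filter (\<lambda>x. snd x = l) b = b" using assms(2) by (auto intro: filter_True)
  ultimately show ?thesis using R_even[OF assms(1), of l] by simp
qed

end

section \<open>Words with a two-coloured block, and the one-block word \<open>xyyx\<close>\<close>

definition mixed :: "lword \<Rightarrow> bool" where
  "mixed xs \<longleftrightarrow> (\<exists>l. (X, l) \<in> set xs \<and> (Y, l) \<in> set xs)"

lemma mixedI: "a \<noteq> b \<Longrightarrow> (a, l) \<in> set xs \<Longrightarrow> (b, l) \<in> set xs \<Longrightarrow> mixed xs"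
  unfolding mixed_def by (metis (full_types) col.exhaust)

lemma mixedE:
  assumes "mixed xs" "a \<noteq> b" obtains l where "(a, l) \<in> set xs" "(b, l) \<in> set xs"
  using assms unfolding mixed_def by (metis (full_types) col.exhaust)

context category
begin

text \<open>Nest \<open>beta(ab,ab)\<close> in the middle of \<open>aaaa\<close> and cap on either
  side: this joins both of its blocks to the outer one.\<close>

lemma beta_to_abba:
  assumes "[(a, 0), (b, 0), (b, 1), (a, 1)] \<in> R" "lbl 0 [a, a, a, a] \<in> R"
  shows "lbl 0 [a, b, b, a] \<in> R"
proof -
  have "lbl 2 [a, a, a, a] \<in> R" using assms(2) R_lbl_iff by blast
  then have "[(a, 2), (a, 2)] @ [(a, 2), (a, 2)] \<in> R" by simp
  from R_insert[OF this assms(1)]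
  have "[(a, 2)] @ [(a, 2), (a, 0)] @ [(b, 0), (b, 1), (a, 1), (a, 2), (a, 2)] \<in> R" by simp
  from R_cap[OF this] have "[(a, 2), (b, 2), (b, 1)] @ [(a, 1), (a, 2)] @ [(a, 2)] \<in> R" by simp
  from R_cap[OF this] have "lbl 1 [a, b, b, a] \<in> R" by simp
  then show ?thesis using R_lbl_iff by blast
qed

text \<open>A disjoint mirror copy of \<open>r\<close> is appended and capped off against
  \<open>r\<close>; no label of \<open>b\<close> takes part, so \<open>b\<close> is left
  unchanged.\<close>

lemma R_factor:
  assumes "b @ r \<in> R" "r \<in> R" "labs b \<inter> labs r = {}"
  shows "b \<in> R"
proof -
  obtain M where M: "\<forall>k\<in>labs (b @ r). k < M" using fresh_label by blast
  let ?s = "\<lambda>k. k + M"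
  let ?t = "rev (relabel ?s r)"
  have "relabel ?s r \<in> R" using assms(2) by (subst R_relabel_iff) (auto simp: inj_on_def)
  then have t: "?t \<in> R" by (rule R_rev)
  have lt: "labs ?t = ?s ` labs r" by (simp add: labs_relabel del: set_map)
  have dis: "k \<notin> labs ?t" if "k \<in> labs (b @ r)" for k
    using M that unfolding lt by (metis imageE not_add_less2)
  then have "labs (b @ r) \<inter> labs ?t = {}" by blast
  from R_append[OF assms(1) t this] have "b @ r @ ?t @ [] \<in> R" by simp
  from R_cap_many[OF this] obtain f where f: "relabel f b \<in> R"
    "\<forall>k. k \<notin> labs r \<union> labs ?t \<longrightarrow> f k = k" by (auto simp: rev_map o_def)
  have "f (snd x) = snd x" if "x \<in> set b" for x
  proof -
    have "snd x \<in> labs b" using that by simp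
    then have "snd x \<notin> labs r \<union> labs ?t" using assms(3) dis[of "snd x"] by auto
    then show ?thesis using f(2) by blast
  qed
  then have "relabel f b = b" by (intro map_idI) (auto simp: prod_eq_iff)
  then show ?thesis using f(1) by simp
qed

lemma R_cap_even: "u @ replicate (2 * m) (a, l) @ v \<in> R \<Longrightarrow> u @ v \<in> R"
proof (induction m)
  case (Suc m)
  then have "u @ [(a, l), (a, l)] @ (replicate (2 * m) (a, l) @ v) \<in> R" by simp
  from R_cap_same[OF this] Suc.IH show ?case by simp
qed simp

end

context even_category
begin

text \<open>Capping adjacent equal letters in a mixed word of minimal length destroys mixedness, which
  leaves only \<open>aabb\<close> as one block, \<open>aabb\<close> as two nested pairs, or an alternating word.\<close>

lemma mixed_cases:
  assumes "zs \<in> R" "mixed zs"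
  shows "\<exists>a b. a \<noteq> b \<and> (lbl 0 [a, b, b, a] \<in> R \<or> [(a, 0), (b, 0), (b, 1), (a, 1)] \<in> R)"
proof -
  obtain xs where xs: "xs \<in> R" "mixed xs"
    and min: "\<And>ys. ys \<in> R \<Longrightarrow> mixed ys \<Longrightarrow> length xs \<le> length ys"
    using ex_has_least_nat[of "\<lambda>xs. xs \<in> R \<and> mixed xs" zs length] assms by blast
  show ?thesis
  proof (cases "\<exists>u a i j v. xs = u @ [(a, i), (a, j)] @ v")
    case True
    then obtain u a i j v where uv: "xs = u @ [(a, i), (a, j)] @ v" by blast
    define r where "r = v @ u"
    define ys where "ys = (a, i) # (a, j) # r"
    have ys: "ys \<in> R" using R_rotate[of u "[(a, i), (a, j)] @ v"] xs(1) uv by (simp add: ys_def r_def)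
    have "set ys = set xs" by (auto simp: ys_def r_def uv)
    then have mys: "mixed ys" using xs(2) by (simp add: mixed_def)
    have min': "length ys \<le> length qs" if "qs \<in> R" "mixed qs" for qs
      using min[OF that] by (simp add: ys_def r_def uv)
    obtain b where b: "a \<noteq> b" and ab: "\<And>c. c = a \<or> c = b"
    proof (cases a)
      case X
      show ?thesis by (rule that[of Y]) (use X col.exhaust in auto)
    next
      case Y
      show ?thesis by (rule that[of X]) (use Y col.exhaust in auto)
    qed
    \<comment> \<open>Capping the two adjacent letters \<open>a\<close> shortens the word, so by
      minimality no mixed block remains.\<close>
    have "relabel (mrg i j) r \<in> R" using R_cap[of "[]" a i j r] ys by (simp add: ys_def)
    then have nm: "\<not> mixed (relabel (mrg i j) r)"
      using min'[of "relabel (mrg i j) r"] by (auto simp: ys_def)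
    define r' where "r' = relabel (mrg i j) r"
    have rl: "(c, i) \<in> set r'" if "(c, k) \<in> set r" "k = i \<or> k = j" for c k
      using that by (force simp: r'_def)
    have rl': "(c, k) \<in> set r'" if "(c, k) \<in> set r" "k \<noteq> j" for c k
      using that by (force simp: r'_def)
    note nm = nm[folded r'_def]
    obtain l where l: "(a, l) \<in> set ys" "(b, l) \<in> set ys" using mixedE[OF mys b] by blast
    have lr: "(b, l) \<in> set r" using l(2) b by (auto simp: ys_def)
    \<comment> \<open>A mixed block other than \<open>i\<close> and \<open>j\<close> would survive
      the cap.\<close>
    have lij: "l = i \<or> l = j"
    proof (rule ccontr)
      assume "\<not> (l = i \<or> l = j)"
      then have "(a, l) \<in> set r'" "(b, l) \<in> set r'" using l(1) lr rl' by (auto simp: ys_def)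
      from mixedI[OF b this] nm show False by simp
    qed
    \<comment> \<open>The cap makes \<open>i\<close> and \<open>j\<close> one label, which already
      carries a \<open>b\<close>; a further \<open>a\<close> would make it mixed.\<close>
    have onlyb: "c = b" if "(c, k) \<in> set r" "k = i \<or> k = j" for c k
    proof (rule ccontr)
      assume "c \<noteq> b"
      then have "(a, k) \<in> set r" using ab[of c] that(1) by auto
      from mixedI[OF b rl[OF this that(2)] rl[OF lr lij]] nm show False by simp
    qed
    \<comment> \<open>A third label would yield an interval block of even length avoiding
      \<open>i\<close> and \<open>j\<close>. Its first two letters have equal colour, and capping
      them keeps the mixed block \<open>l\<close>, against minimality.\<close>
    have labr: "snd x = i \<or> snd x = j" if "x \<in> set r" for x
    proof (rule ccontr)
      assume nij: "\<not> (snd x = i \<or> snd x = j)"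
      have "x \<in> set ys" using that by (simp add: ys_def)
      then obtain q where q: "q < length ys" "ys ! q = x" by (metis in_set_conv_nth)
      \<comment> \<open>Positions 0 and 1 carry \<open>i\<close> and \<open>j\<close>, so another
        letter with one of these labels under an arc of a third label would produce a
        crossing.\<close>
      have cl: "\<not> (snd (ys ! j') = i \<or> snd (ys ! j') = j)"
        if h: "i' < j'" "j' < k'" "k' < length ys" "snd (ys ! i') = snd (ys ! k')"
          "\<not> (snd (ys ! i') = i \<or> snd (ys ! i') = j)" for i' j' k'
      proof
        have i': "1 < i'"
        proof (rule ccontr)
          assume "\<not> 1 < i'"
          then have "i' = 0 \<or> i' = 1" by auto
          then show False using h(5) by (auto simp: ys_def)
        qed
        assume "snd (ys ! j') = i \<or> snd (ys ! j') = j"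
        then show False
        proof
          assume "snd (ys ! j') = i"
          then show False using nclD[OF R_ncl[OF ys], of 0 i' j' k'] h i' by (simp add: ys_def)
        next
          assume "snd (ys ! j') = j"
          then show False using nclD[OF R_ncl[OF ys], of 1 i' j' k'] h i' by (simp add: ys_def)
        qed
      qed
      obtain u' c v' l' where c: "ys = u' @ c @ v'" "c \<noteq> []" "labs c \<subseteq> {l'}"
        "\<not> (l' = i \<or> l' = j)" "l' \<notin> labs (u' @ v')"
        using interval_block[OF R_ncl[OF ys] q(1), of "\<lambda>l. \<not> (l = i \<or> l = j)"] cl nij q(2) by blast
      have "even (length c)" using even_interval c ys by metis
      then obtain x1 x2 c' where c': "c = x1 # x2 # c'" using c(2)
        by (cases c; cases "tl c") auto
      obtain c1 c2 where x: "x1 = (c1, l')" "x2 = (c2, l')"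
        using c(3) c' by (cases x1; cases x2) auto
      have inr: "(c1, l') \<in> set r" "(c2, l') \<in> set r"
      proof -
        have "(c1, l') \<in> set ys" "(c2, l') \<in> set ys" using c(1) c' x by auto
        then show "(c1, l') \<in> set r" "(c2, l') \<in> set r" using c(4) by (auto simp: ys_def)
      qed
      have "c1 = c2"
      proof (rule ccontr)
        assume "c1 \<noteq> c2"
        moreover have "l' \<noteq> j" using c(4) by simp
        ultimately have "mixed r'" using rl'[OF inr(1)] rl'[OF inr(2)] by (rule_tac mixedI)
        then show False using nm by simp
      qed
      then have "u' @ [(c1, l'), (c1, l')] @ (c' @ v') \<in> R" using ys c(1) c' x by simp
      then have qs: "u' @ (c' @ v') \<in> R" by (rule R_cap_same)
      have keep: "y \<in> set (u' @ (c' @ v'))" if "y \<in> set ys" "snd y = i \<or> snd y = j" for y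
        using that c(1,4) c' x by auto
      have "(a, l) \<in> set (u' @ (c' @ v'))" "(b, l) \<in> set (u' @ (c' @ v'))"
        using keep l lij by auto
      from mixedI[OF b this] min'[OF qs] show False using c(1) c' by simp
    qed
    have r: "x = (b, snd x) \<and> (snd x = i \<or> snd x = j)" if "x \<in> set r" for x
      using labr[OF that] onlyb[of "fst x" "snd x"] that by (cases x) auto
    \<comment> \<open>With three letters \<open>b\<close>, capping the first two leaves the third,
      which still shares its block with one of the letters \<open>a\<close>.\<close>
    have "length r < 3"
    proof (rule ccontr)
      assume "\<not> length r < 3"
      then obtain y1 y2 y3 r'' where r'': "r = y1 # y2 # y3 # r''"
        by (cases r; cases "tl r"; cases "tl (tl r)") auto
      obtain k1 k2 k3 where k: "y1 = (b, k1)" "y2 = (b, k2)" "y3 = (b, k3)" "k3 = i \<or> k3 = j"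
        using r[of y1] r[of y2] r[of y3] r'' by auto
      let ?m = "mrg k1 k2"
      have "[(a, i), (a, j)] @ [(b, k1), (b, k2)] @ ((b, k3) # r'') \<in> R"
        using ys r'' k by (simp add: ys_def)
      from R_cap[OF this] have c: "relabel ?m ([(a, i), (a, j)] @ (b, k3) # r'') \<in> R" .
      have "(a, ?m k3) \<in> set (relabel ?m ([(a, i), (a, j)] @ (b, k3) # r''))"
        "(b, ?m k3) \<in> set (relabel ?m ([(a, i), (a, j)] @ (b, k3) # r''))"
        using k(4) by auto
      from min'[OF c mixedI[OF b this]] show False using r'' by (simp add: ys_def)
    qed
    moreover have "length r \<noteq> 1"
    proof
      assume "length r = 1"
      then obtain k where "r = [(b, k)]" using r by (cases r) auto
      then show False using R_even[OF ys, of i] R_even[OF ys, of j] R_even[OF ys, of k]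
        by (auto simp: ys_def split: if_splits)
    qed
    moreover have "r \<noteq> []" using lr by auto
    ultimately have "length r = 2" by (cases "length r") auto
    then obtain y1 y2 where y: "r = [y1, y2]" by (cases r; cases "tl r") auto
    then obtain k1 k2 where k: "r = [(b, k1), (b, k2)]" "k1 = i \<or> k1 = j" "k2 = i \<or> k2 = j"
      using r[of y1] r[of y2] by auto
    show ?thesis
    proof (cases "i = j")
      case True
      then have "lbl i ([a] @ [a, b, b]) \<in> R" using ys k by (simp add: ys_def)
      then have "lbl 0 ([a] @ [a, b, b]) \<in> R" using R_lbl_iff by blast
      from R_lbl_rotate[OF this] have "lbl 0 [a, b, b, a] \<in> R" by simp
      then show ?thesis using b by blast
    next
      case False
      then have "k1 = j \<and> k2 = i \<or> k1 = i \<and> k2 = j"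
        using R_even[OF ys, of i] R_even[OF ys, of j] k by (auto simp: ys_def split: if_splits)
      \<comment> \<open>The labels \<open>i, j, i, j\<close> cross; the remaining pattern
        \<open>i, j, j, i\<close> is \<open>beta(ba,ba)\<close> up to rotation.\<close>
      moreover have "\<not> (k1 = i \<and> k2 = j)"
        using nclD[OF R_ncl[OF ys], of 0 1 2 3] False k by (auto simp: ys_def)
      ultimately have "[(a, i), (a, j), (b, j)] @ [(b, i)] \<in> R" using ys k by (auto simp: ys_def)
      from R_rotate[OF this] have "lbl i [b, a] @ rev (lbl j [b, a]) \<in> R" by simp
      then have "lbl 0 [b, a] @ rev (lbl 1 [b, a]) \<in> R"
        using R_lbl2_iff[OF False, of 0 1 "[b, a]" "[b, a]"] by simp
      then show ?thesis using b by (intro exI[of _ b] exI[of _ a]) auto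
    qed
  next
    case False
    \<comment> \<open>Now adjacent letters always differ in colour, so an interval block starts with
      two distinct colours. Whether its label recurs beyond these two letters decides between
      \<open>abba\<close> and \<open>beta(ab,ab)\<close>.\<close>
    have "xs \<noteq> []" using xs(2) by (auto simp: mixed_def)
    then obtain u c v l where c: "xs = u @ c @ v" "c \<noteq> []" "labs c \<subseteq> {l}" "l \<notin> labs (u @ v)"
      using interval_block_all[OF R_ncl[OF xs(1)]] by blast
    have "even (length c)" using even_interval c xs(1) by metis
    then obtain x1 x2 c' where c': "c = x1 # x2 # c'" using c(2) by (cases c; cases "tl c") auto
    obtain a b where x: "x1 = (a, l)" "x2 = (b, l)" using c(3) c' by (cases x1; cases x2) auto
    have "a \<noteq> b"
    proof
      assume "a = b"
      then have "xs = u @ [(a, l), (a, l)] @ (c' @ v)" using c(1) c' x by simp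
      then show False using False by blast
    qed
    have q: "[(a, l), (b, l)] @ (c' @ v @ u) \<in> R" using R_rotate[of u "c @ v"] xs(1) c(1) c' x by simp
    show ?thesis
    proof (cases "l \<in> labs (c' @ v @ u)")
      case True
      then have "lbl 0 [a, b, b, a] \<in> R" using R_double[OF q, of l] by simp
      then show ?thesis using \<open>a \<noteq> b\<close> by blast
    next
      case False
      then have "[(a, 0), (b, 0), (b, 1), (a, 1)] \<in> R" using R_beta[OF q, of l] by simp
      then show ?thesis using \<open>a \<noteq> b\<close> by blast
    qed
  qed
qed

text \<open>One instance with distinct colours suffices: rotation exchanges the colours, and
  doubling \<open>xx\<close> or \<open>yy\<close> gives the monochromatic cases. If only
  \<open>beta\<close> is available, it is upgraded by means of \<open>cccc\<close>.\<close>

lemma abba_in_R: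
  assumes "zs \<in> R" "mixed zs" "lbl 0 [c, c, c, c] \<in> R"
  shows "lbl 0 [a, b, b, a] \<in> R"
proof -
  obtain x y where xy: "x \<noteq> y" "lbl 0 [x, y, y, x] \<in> R"
  proof -
    obtain p q where pq: "p \<noteq> q" "lbl 0 [p, q, q, p] \<in> R \<or> [(p, 0), (q, 0), (q, 1), (p, 1)] \<in> R"
      using mixed_cases[OF assms(1,2)] by blast
    show ?thesis
    proof (cases "lbl 0 [p, q, q, p] \<in> R")
      case False
      then have be: "[(p, 0), (q, 0)] @ [(q, 1), (p, 1)] \<in> R" using pq by simp
      have "c = p \<or> c = q" using pq(1) by (metis (full_types) col.exhaust)
      then show ?thesis
      proof
        assume "c = p"
        then show ?thesis using that[OF pq(1)] beta_to_abba[of p q] be assms(3) by simp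
      next
        assume "c = q"
        \<comment> \<open>Rotation exchanges the inner and outer colours of \<open>beta\<close>, so
          that the outer one is \<open>c\<close>.\<close>
        have "lbl 1 [q, p] @ rev (lbl 0 [q, p]) \<in> R" using R_rotate[OF be] by simp
        then have "lbl 0 [q, p] @ rev (lbl 1 [q, p]) \<in> R"
          using R_lbl2_iff[of 0 1 1 0 "[q, p]" "[q, p]"] by simp
        then show ?thesis using that[of q p] pq(1) beta_to_abba[of q p] assms(3) \<open>c = q\<close> by simp
      qed
    qed (use that pq in blast)
  qed
  have xxyy: "lbl 0 [x, x] @ lbl 0 [y, y] \<in> R" using R_lbl_rotate[of "[x, y, y]" "[x]"] xy(2) by simp
  then have yyxx: "lbl 0 [y, y] @ lbl 0 [x, x] \<in> R" by (rule R_rotate)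
  have "lbl 0 [x, x, x, x] \<in> R" "lbl 0 [y, y, y, y] \<in> R"
    using R_double[OF xxyy, of 0] R_double[OF yyxx, of 0] by simp_all
  moreover have "lbl 0 [y, x, x, y] \<in> R" using R_lbl_rotate[of "[y]" "[y, x, x]"] yyxx
    R_lbl_rotate[of "[x, y, y]" "[x]"] xy(2) R_lbl_rotate[of "[x, x, y]" "[y]"] by simp
  moreover have "(a = x \<or> a = y) \<and> (b = x \<or> b = y)" using xy(1) by (metis (full_types) col.exhaust)
  ultimately show ?thesis using xy(2) by auto
qed

end

section \<open>Generated categories and free products\<close>

lemma is_category_Inter:
  assumes "F \<noteq> {}" "\<And>D. D \<in> F \<Longrightarrow> is_category D"
  shows "is_category (\<Inter>F)"
proof -
  note cr = category.cat_rules[OF category.intro[OF assms(2)]]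
  obtain D where D: "D \<in> F" using assms(1) by blast
  show ?thesis unfolding is_category_def
  proof (intro conjI ballI allI impI)
    fix p assume "p \<in> \<Inter>F"
    then show "noncrossing p" using cr(1)[OF D] D by blast
  next
    fix p q assume "p \<in> \<Inter>F" "q \<in> \<Inter>F"
    then show "tensor p q \<in> \<Inter>F" by (intro InterI cr(2)) auto
  next
    fix p q assume "p \<in> \<Inter>F" "q \<in> \<Inter>F" "lo p = up q"
    then show "comp q p \<in> \<Inter>F" by (intro InterI cr(3)) auto
  next
    fix p assume "p \<in> \<Inter>F"
    then show "adj p \<in> \<Inter>F" by (intro InterI cr(4)) auto
  next
    fix p assume "p \<in> \<Inter>F" "up p \<noteq> []"
    then show "rotUL p \<in> \<Inter>F" "rotUR p \<in> \<Inter>F" by (intro InterI cr(5,7); simp)+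
  next
    fix p assume "p \<in> \<Inter>F" "lo p \<noteq> []"
    then show "rotLU p \<in> \<Inter>F" "rotLR p \<in> \<Inter>F" by (intro InterI cr(6,8); simp)+
  next
    fix a show "pi_part [a] [a] \<in> \<Inter>F" by (intro InterI cr(9))
  qed
qed

text \<open>The category \<open>C\<close> witnesses that the intersection defining
  \<open>gen_cat\<close> ranges over a nonempty family.\<close>

lemma gen_cat_category:
  assumes "is_category C" "S \<subseteq> C"
  shows "is_category (gen_cat S)" "S \<subseteq> gen_cat S" "gen_cat S \<subseteq> C"
proof -
  show "is_category (gen_cat S)" unfolding gen_cat_def
    by (rule is_category_Inter) (use assms in auto)
qed (use assms in \<open>auto simp: gen_cat_def\<close>)

lemma category_subsetI:
  assumes "category C" "category G" "lwords C \<subseteq> lwords G"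
  shows "C \<subseteq> G"
proof
  fix p assume "p \<in> C"
  then obtain us ls where "p = lpart us ls" "ls @ rev us \<in> lwords C"
    using category.in_cat_lpart[OF assms(1)] by blast
  then show "p \<in> G" using category.lpart_in_iff[OF assms(2)] assms(3) by blast
qed

text \<open>An interval block is monochromatic of even size, so capping it away leaves a shorter
  word of \<open>C\<close>, and by \<open>R_factor\<close> the block itself lies in
  \<open>C\<close>, hence among the monochromatic generators. Reinserting it rebuilds the word in
  the generated category.\<close>

lemma (in even_category) unmixed_free_product:
  assumes "\<And>xs. xs \<in> R \<Longrightarrow> \<not> mixed xs"
  shows "free_product C"
proof -
  define S where "S = {p \<in> C. mono_part X p} \<union> {p \<in> C. mono_part Y p}"
  define G where "G = gen_cat S"
  have SC: "S \<subseteq> C" by (auto simp: S_def)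
  note G = gen_cat_category[OF is_cat SC, folded G_def]
  interpret G: category G using G(1) by unfold_locales
  have "xs \<in> G.R" if "xs \<in> R" for xs
    using that
  proof (induction xs rule: length_induct)
    case (1 xs)
    show ?case
    proof (cases "xs = []")
      case True
      then show ?thesis using G.R_Nil by simp
    next
      case False
      then obtain u b v l where ub: "xs = u @ b @ v" "b \<noteq> []" "labs b \<subseteq> {l}" "l \<notin> labs (u @ v)"
        using interval_block_all[OF R_ncl[OF 1(2)]] by blast
      obtain x0 where "x0 \<in> set b" using ub(2) by (cases b) auto
      moreover define a where "a = fst x0"
      ultimately have "x0 = (a, l)" using ub(3) by (auto simp: prod_eq_iff)
      with \<open>x0 \<in> set b\<close> have a: "(a, l) \<in> set b" by simp
      have ball: "x = (a, l)" if "x \<in> set b" for x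
      proof -
        have "x = (fst x, l)" using ub(3) that by (auto simp: prod_eq_iff)
        moreover have "\<not> mixed b" using assms[OF 1(2)] ub(1) by (auto simp: mixed_def)
        ultimately show ?thesis using mixedI[of "fst x" a l b] a that by metis
      qed
      have "even (length b)" using even_interval[of u b v l] 1(2) ub by simp
      then obtain m where m: "length b = 2 * m" by blast
      have b: "b = replicate (2 * m) (a, l)" using ball m by (metis replicate_length_same)
      have uv: "u @ v \<in> R" using R_cap_even[of u m a l v] 1(2) ub(1) b by simp
      moreover have "length (u @ v) < length xs" using ub(1,2) by simp
      ultimately have uvG: "u @ v \<in> G.R" using 1(1) by blast
      have disj: "labs b \<inter> labs (u @ v) = {}" using ub(3,4) by blast
      have "b @ (v @ u) \<in> R" using R_rotate[of u "b @ v"] 1(2) ub(1) by simp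
      moreover have "labs b \<inter> labs (v @ u) = {}" using disj by auto
      ultimately have "b \<in> R" using R_factor[of b "v @ u"] R_rotate[OF uv] by blast
      moreover have "mono_part a (lpart [] b)" using ball by (auto simp: mono_part_def)
      ultimately have "lpart [] b \<in> S" by (cases a) (auto simp: S_def lwords_def)
      then have "b \<in> G.R" using G(2) by (auto simp: lwords_def)
      then show ?thesis using G.R_insert[OF uvG _ disj] ub(1) by simp
    qed
  qed
  then have "C \<subseteq> G" using category_subsetI[of C G] category_axioms G.category_axioms by blast
  then show ?thesis using G(3) unfolding free_product_def G_def S_def by blast
qed

section \<open>Words in the dihedral groups\<close>

lemma xy_pow_simps [simp]: "xy_pow 0 = []" "xy_pow (Suc k) = X # Y # xy_pow k"
  by (simp_all add: xy_pow_def)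

lemma yx_pow_simps [simp]: "yx_pow 0 = []" "yx_pow (Suc k) = Y # X # yx_pow k"
  by (simp_all add: yx_pow_def)

lemma xy_pow_add: "xy_pow (j + k) = xy_pow j @ xy_pow k"
  by (simp add: xy_pow_def replicate_add)

lemma yx_pow_add: "yx_pow (j + k) = yx_pow j @ yx_pow k"
  by (simp add: yx_pow_def replicate_add)

lemma rev_xy_pow: "rev (xy_pow k) = yx_pow k"
  using yx_pow_add[of _ 1] by (induction k) auto

lemma gamma_eq_cong: "gamma_eq d u v \<Longrightarrow> gamma_eq d (s @ u @ t) (s @ v @ t)"
proof (induction rule: gamma_eq.induct)
  case (relX u v) then show ?case using gamma_eq.relX[of d "s @ u" "v @ t"] by simp
next
  case (relY u v) then show ?case using gamma_eq.relY[of d "s @ u" "v @ t"] by simp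
next
  case (relD u v) then show ?case using gamma_eq.relD[of d "s @ u" "v @ t"] by simp
qed (blast intro: gamma_eq.intros)+

lemma gamma_eq_pair: "gamma_eq d (u @ [a, a] @ v) (u @ v)"
  using gamma_eq.relX gamma_eq.relY by (cases a) auto

text \<open>The generators are involutions, so the reversed word represents the inverse.\<close>

lemma gamma_eq_rev_cancel: "gamma_eq d (u @ rev u) []"
proof (induction u)
  case (Cons a u)
  have "gamma_eq d ([a] @ (u @ rev u) @ [a]) ([a] @ [] @ [a])" by (rule gamma_eq_cong[OF Cons])
  from gamma_eq.trans[OF this] show ?case using gamma_eq_pair[of d "[]" a "[]"] by simp
qed (simp add: gamma_eq.refl)

lemma gamma_eq_rev_Nil:
  assumes "gamma_eq d u []" shows "gamma_eq d (rev u) []"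
proof -
  have "gamma_eq d (u @ rev u) (rev u)" using gamma_eq_cong[OF assms, of "[]" "rev u"] by simp
  then show ?thesis using gamma_eq_rev_cancel[of d u] gamma_eq.intros by blast
qed

lemma gamma_eq_xy_pow_mult: "gamma_eq d (xy_pow (d * k)) []"
proof (induction k)
  case (Suc k)
  have "gamma_eq d ([] @ xy_pow d @ xy_pow (d * k)) ([] @ xy_pow (d * k))" by (rule gamma_eq.relD)
  from gamma_eq.trans[OF this] Suc show ?case by (simp add: xy_pow_add)
qed (simp add: gamma_eq.refl)

text \<open>Words of even length represent powers of \<open>xy\<close>, the negative ones written as
  powers of \<open>yx\<close>. Prepending two letters changes the exponent by at most one.\<close>

lemma gamma_eq_normal_form:
  "even (length w) \<Longrightarrow> \<exists>k. gamma_eq d w (xy_pow k) \<or> gamma_eq d w (yx_pow k)"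
proof (induction w rule: length_induct)
  case (1 w)
  show ?case
  proof (cases w)
    case Nil
    then show ?thesis by (intro exI[of _ 0]) (simp add: gamma_eq.refl)
  next
    case (Cons a w1)
    then obtain b w' where w: "w = [a, b] @ w'" using 1(2) by (cases w1) auto
    then have "length w' < length w" "even (length w')" using 1(2) by auto
    then obtain k where k: "gamma_eq d w' (xy_pow k) \<or> gamma_eq d w' (yx_pow k)" using 1(1) by blast
    have st: "gamma_eq d w ([a, b] @ z)" if "gamma_eq d w' z" for z
      using gamma_eq_cong[OF that, of "[a, b]" "[]"] w by simp
    have pr: "gamma_eq d ([c, c] @ z) z" for c z using gamma_eq_pair[of d "[]" c z] by simp
    have pr2: "gamma_eq d ([c] @ [e, e] @ [c] @ z) z" for c e z
      using gamma_eq.trans[OF gamma_eq_pair[of d "[c]" e "[c] @ z"]] pr[of c z] by simp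
    show ?thesis
    proof (cases "a = b")
      case True
      then show ?thesis using k st pr gamma_eq.trans by metis
    next
      case False
      from k show ?thesis
      proof
        assume k: "gamma_eq d w' (xy_pow k)"
        show ?thesis
        proof (cases a)
          case X
          then have "gamma_eq d w (xy_pow (Suc k))" using False st[OF k] by (cases b) auto
          then show ?thesis by blast
        next
          case Y
          then have b: "b = X" using False by (cases b) auto
          show ?thesis
          proof (cases k)
            case 0
            then have "gamma_eq d w (yx_pow 1)" using st[OF k] Y b by simp
            then show ?thesis by blast
          next
            case (Suc k')
            then have "gamma_eq d ([a, b] @ xy_pow k) (xy_pow k')"
              using Y b pr2[of Y X "xy_pow k'"] by simp
            from gamma_eq.trans[OF st[OF k] this] show ?thesis by blast
          qed
        qed
      next
        assume k: "gamma_eq d w' (yx_pow k)"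
        show ?thesis
        proof (cases a)
          case Y
          then have "gamma_eq d w (yx_pow (Suc k))" using False st[OF k] by (cases b) auto
          then show ?thesis by blast
        next
          case X
          then have b: "b = Y" using False by (cases b) auto
          show ?thesis
          proof (cases k)
            case 0
            then have "gamma_eq d w (xy_pow 1)" using st[OF k] X b by simp
            then show ?thesis by blast
          next
            case (Suc k')
            then have "gamma_eq d ([a, b] @ yx_pow k) (yx_pow k')"
              using X b pr2[of X Y "yx_pow k'"] by simp
            from gamma_eq.trans[OF st[OF k] this] show ?thesis by blast
          qed
        qed
      qed
    qed
  qed
qed

text \<open>The generator is the least positive member, or 0 if there is none; the value 0 stands
  for the infinite group \<open>Gamma_0\<close> or for the trivial subgroup.\<close>

lemma nat_subgroup_generator:
  fixes K :: "nat set"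
  assumes "0 \<in> K" "\<And>j k. j \<in> K \<Longrightarrow> k \<in> K \<Longrightarrow> j \<le> k \<Longrightarrow> k - j \<in> K"
  obtains d where "d \<in> K" "\<And>k. k \<in> K \<Longrightarrow> d dvd k"
proof (cases "K \<subseteq> {0}")
  case True
  then show ?thesis using that[of 0] assms(1) by auto
next
  case False
  define d where "d = (LEAST k. k \<in> K \<and> k > 0)"
  obtain k0 where "k0 \<in> K" "k0 \<noteq> 0" using False by blast
  then have d: "d \<in> K" "d > 0" using LeastI[of "\<lambda>k. k \<in> K \<and> k > 0" k0] by (auto simp: d_def)
  have "d dvd k" if "k \<in> K" for k
    using that
  proof (induction k rule: less_induct)
    case (less k)
    show ?case
    proof (cases "d \<le> k")
      case True
      then have "d dvd k - d" using less d assms(2)[of d k] by auto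
      then show ?thesis using True by (simp add: dvd_minus_self)
    next
      case False
      then have "\<not> (k \<in> K \<and> k > 0)" unfolding d_def by (intro not_less_Least) simp
      then show ?thesis using less.prems by simp
    qed
  qed
  then show ?thesis using that d(1) by blast
qed

section \<open>One-block and two-block words\<close>

text \<open>Drawn in two rows, the assumption says that every \<open>\<pi>(ab,ab)\<close>, including
  \<open>a = b\<close>, belongs to the category.\<close>

locale abba_category = category +
  assumes abba: "\<And>a b. lbl 0 [a, b, b, a] \<in> R"
begin

text \<open>A fresh block \<open>aabb\<close> is inserted between the two letters. Capping its outer
  letters against them joins \<open>i\<close> and \<open>j\<close>, and its inner letters
  \<open>a\<close> and \<open>b\<close> take their place.\<close>

lemma R_merge:
  assumes "u @ [(a, i), (b, j)] @ v \<in> R"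
  shows "relabel (mrg i j) (u @ [(a, i), (b, j)] @ v) \<in> R"
proof -
  obtain M where M: "\<forall>k\<in>labs (u @ [(a, i), (b, j)] @ v). k < M" using fresh_label by blast
  have "lbl 0 ([a] @ [a, b, b]) \<in> R" using R_lbl_rotate[of "[a, b, b]" "[a]"] abba by simp
  then have "lbl M [a, a, b, b] \<in> R" using R_lbl_iff[of M "[a, a, b, b]" 0] by simp
  moreover have fr: "M \<notin> labs (u @ [(a, i)] @ [(b, j)] @ v)"
  proof
    assume "M \<in> labs (u @ [(a, i)] @ [(b, j)] @ v)"
    then have "M \<in> labs (u @ [(a, i), (b, j)] @ v)" by simp
    from bspec[OF M this] show False by simp
  qed
  then have "labs (lbl M [a, a, b, b]) \<inter> labs ((u @ [(a, i)]) @ [(b, j)] @ v) = {}" by simp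
  moreover have "(u @ [(a, i)]) @ [(b, j)] @ v \<in> R" using assms by simp
  ultimately have "(u @ [(a, i)]) @ lbl M [a, a, b, b] @ [(b, j)] @ v \<in> R" using R_insert by blast
  then have "u @ [(a, i), (a, M)] @ ([(a, M), (b, M), (b, M), (b, j)] @ v) \<in> R" by simp
  from R_cap[OF this]
  have "relabel (mrg i M) u @ relabel (mrg i M) [(a, M), (b, M), (b, M), (b, j)] @ relabel (mrg i M) v \<in> R"
    by simp
  moreover have "relabel (mrg i M) u = u" "relabel (mrg i M) v = v" "j \<noteq> M"
    using fr by (auto intro: relabel_fresh)
  ultimately have "(u @ [(a, i), (b, i)]) @ [(b, i), (b, j)] @ v \<in> R" by simp
  from R_cap[OF this] show ?thesis by simp
qed

lemma one_block_rev: "lbl 0 u \<in> R \<Longrightarrow> lbl 0 (rev u) \<in> R"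
  using R_rev[of "lbl 0 u"] by (simp add: rev_map)

lemma one_block_append:
  assumes "lbl 0 u \<in> R" "lbl 0 v \<in> R" shows "lbl 0 (u @ v) \<in> R"
proof (cases "u = [] \<or> v = []")
  case False
  then obtain u' a b v' where uv: "u = u' @ [a]" "v = b # v'" by (metis list.exhaust rev_exhaust)
  have "lbl 1 v \<in> R" using assms(2) R_lbl_iff by blast
  then have "lbl 0 u @ lbl 1 v \<in> R" using assms(1) by (intro R_append) auto
  then have "lbl 0 u' @ [(a, 0), (b, 1)] @ lbl 1 v' \<in> R" by (simp add: uv)
  from R_merge[OF this] show ?thesis by (simp add: uv o_def)
qed (use assms in auto)

lemma one_block_insert:
  assumes "lbl 0 z \<in> R" "lbl 0 (u @ v) \<in> R" shows "lbl 0 (u @ z @ v) \<in> R"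
  using R_lbl_rotate[of v "u @ z"] one_block_append[OF R_lbl_rotate[OF assms(2)] assms(1)] by simp

text \<open>The word \<open>rev z\<close> is inserted right after \<open>z\<close>, where the two
  cancel.\<close>

lemma one_block_remove:
  assumes "lbl 0 z \<in> R" "lbl 0 (u @ z @ v) \<in> R" shows "lbl 0 (u @ v) \<in> R"
proof -
  have "lbl 0 ((u @ z) @ rev z @ v) \<in> R"
    using one_block_insert[OF one_block_rev[OF assms(1)], of "u @ z" v] assms(2) by simp
  then have "lbl 0 u @ lbl 0 z @ rev (lbl 0 z) @ lbl 0 v \<in> R" by (simp add: rev_map)
  from R_cancel_same[OF this] show ?thesis by simp
qed

text \<open>The relators \<open>XX\<close>, \<open>YY\<close> and \<open>xy_pow d\<close> are
  one-block words of the category, so they can be inserted into and removed from any other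
  one.\<close>

lemma one_block_gamma_eq:
  assumes "gamma_eq d u v" "lbl 0 (xy_pow d) \<in> R"
  shows "lbl 0 (s @ u @ t) \<in> R \<longleftrightarrow> lbl 0 (s @ v @ t) \<in> R"
  using assms(1)
proof (induction arbitrary: s t rule: gamma_eq.induct)
  case (relX u v)
  show ?case using one_block_insert[of "[X, X]" "s @ u" "v @ t"] one_block_remove[of "[X, X]" "s @ u" "v @ t"]
    R_pair[of X 0] by auto
next
  case (relY u v)
  show ?case using one_block_insert[of "[Y, Y]" "s @ u" "v @ t"] one_block_remove[of "[Y, Y]" "s @ u" "v @ t"]
    R_pair[of Y 0] by auto
next
  case (relD u v)
  show ?case using one_block_insert[of "xy_pow d" "s @ u" "v @ t"] one_block_remove[of "xy_pow d" "s @ u" "v @ t"]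
    assms(2) by auto
qed auto

text \<open>The one-row form of \<open>beta(w,w)\<close>: lower row labelled 0, upper row labelled 1
  and read backwards.\<close>

definition two_block :: "col list \<Rightarrow> bool" where
  "two_block w \<longleftrightarrow> lbl 0 w @ rev (lbl 1 w) \<in> R"

lemma two_block_iff: "i \<noteq> j \<Longrightarrow> lbl i w @ rev (lbl j w) \<in> R \<longleftrightarrow> two_block w"
  unfolding two_block_def by (rule R_lbl2_iff) auto

lemma two_block_Nil: "two_block []"
  by (simp add: two_block_def R_Nil)

lemma two_block_of_one_block:
  assumes "lbl 0 w \<in> R" shows "two_block w"
proof -
  have "lbl 1 (rev w) \<in> R" using one_block_rev[OF assms] R_lbl_iff by blast
  then have "rev (lbl 1 w) \<in> R" by (simp add: rev_map)
  then show ?thesis unfolding two_block_def using assms by (intro R_append) auto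
qed

lemma two_block_rev: "two_block u \<Longrightarrow> two_block (rev u)"
  using R_rotate[of "lbl 0 u" "rev (lbl 1 u)"] two_block_iff[of 1 0 "rev u"]
  by (simp add: two_block_def rev_map)

text \<open>Nest \<open>beta(v,v)\<close> inside \<open>beta(u,u)\<close> and merge the blocks at
  both junctions.\<close>

lemma two_block_append:
  assumes "two_block u" "two_block v" shows "two_block (u @ v)"
proof (cases "u = [] \<or> v = []")
  case False
  then obtain u' a b v' where uv: "u = u' @ [a]" "v = b # v'" by (metis list.exhaust rev_exhaust)
  have v: "lbl 2 v @ rev (lbl 3 v) \<in> R" using two_block_iff[of 2 3 v] assms(2) by simp
  have "lbl 0 u @ (lbl 2 v @ rev (lbl 3 v)) @ rev (lbl 1 u) \<in> R"
    using assms(1)[unfolded two_block_def] v by (rule R_insert) auto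
  then have "lbl 0 u' @ [(a, 0), (b, 2)] @ (lbl 2 v' @ rev (lbl 3 v) @ rev (lbl 1 u)) \<in> R"
    by (simp add: uv)
  from R_merge[OF this]
  have "(lbl 0 u @ lbl 0 v @ rev (lbl 3 v')) @ [(b, 3), (a, 1)] @ rev (lbl 1 u') \<in> R"
    by (simp add: uv o_def rev_map)
  from R_merge[OF this] have "lbl 0 (u @ v) @ rev (lbl 3 (u @ v)) \<in> R"
    by (simp add: uv o_def rev_map)
  then show ?thesis using two_block_iff[of 0 3 "u @ v"] by simp
qed (use assms in auto)

text \<open>Since \<open>u\<close> and \<open>v\<close> are equal in the group,
  \<open>v @ rev u\<close> and \<open>u @ rev v\<close> are one-block words. Placing them on the two
  sides of \<open>beta(u,u)\<close> and cancelling \<open>u\<close> twice leaves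
  \<open>beta(v,v)\<close>.\<close>

lemma two_block_gamma_eq:
  assumes "gamma_eq d u v" "lbl 0 (xy_pow d) \<in> R" "two_block u"
  shows "two_block v"
proof -
  have "lbl 0 (u @ rev u) \<in> R"
    using one_block_gamma_eq[OF gamma_eq_rev_cancel[of d u] assms(2), of "[]" "[]"] R_Nil by simp
  then have vu: "lbl 0 (v @ rev u) \<in> R"
    using one_block_gamma_eq[OF assms(1,2), of "[]" "rev u"] by simp
  show ?thesis
  \<comment> \<open>Merging by \<open>R_cancel\<close> requires a nonempty word, so the empty
    \<open>u\<close> is treated apart.\<close>
  proof (cases "u = []")
    case True
    then show ?thesis using vu two_block_of_one_block by simp
  next
    case False
    have 1: "lbl 2 (v @ rev u) \<in> R" using vu R_lbl_iff by blast
    have "lbl 0 (u @ rev v) \<in> R" using one_block_rev[OF vu] by simp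
    then have 2: "lbl 3 (u @ rev v) \<in> R" using R_lbl_iff by blast
    have "lbl 2 (v @ rev u) @ (lbl 0 u @ rev (lbl 1 u)) \<in> R"
      using 1 assms(3)[unfolded two_block_def] by (rule R_append) auto
    from this 2 have "(lbl 2 (v @ rev u) @ (lbl 0 u @ rev (lbl 1 u))) @ lbl 3 (u @ rev v) \<in> R"
      by (rule R_append) auto
    then have "lbl 2 v @ lbl 2 (rev u) @ rev (lbl 0 (rev u)) @ (rev (lbl 1 u) @ lbl 3 u @ rev (lbl 3 v)) \<in> R"
      by (simp add: rev_map)
    from R_cancel[OF this] False
    have "lbl 2 v @ lbl 1 (rev u) @ rev (lbl 3 (rev u)) @ rev (lbl 3 v) \<in> R"
      by (simp add: rev_map o_def)
    from R_cancel[OF this] False have "lbl 2 v @ rev (lbl 1 v) \<in> R" by (simp add: rev_map o_def)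
    then show ?thesis using two_block_iff[of 2 1 v] by simp
  qed
qed

end

section \<open>The categories of free wreath products of pairs\<close>

abbreviation fil :: "nat \<Rightarrow> lword \<Rightarrow> col list" where
  "fil l xs \<equiv> map fst (filter (\<lambda>x. snd x = l) xs)"

lemma fil_conv_sorted_list:
  "map (\<lambda>i. map fst xs ! i) (sorted_list_of_set {i. i < length xs \<and> snd (xs ! i) = l}) = fil l xs"
proof -
  let ?is = "filter (\<lambda>i. snd (xs ! i) = l) [0..<length xs]"
  have "sorted ?is" "distinct ?is" by (simp_all add: sorted_wrt_filter)
  from sorted_list_of_set.idem_if_sorted_distinct[OF this]
  have s: "sorted_list_of_set {i. i < length xs \<and> snd (xs ! i) = l} = ?is" by simp
  have "filter (\<lambda>x. snd x = l) xs = filter (\<lambda>x. snd x = l) (map (nth xs) [0..<length xs])"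
    by (simp add: map_nth)
  also have "\<dots> = map (nth xs) ?is" by (simp add: filter_map o_def)
  finally have "fil l xs = map fst (map (nth xs) ?is)" by (simp only:)
  then show ?thesis unfolding s by auto
qed

lemma blocks_lpart:
  "blocks (lpart us ls) =
     (\<lambda>l. {s \<in> pts (length us) (length ls). lab us ls s = l}) ` (labs us \<union> labs ls)"
proof -
  have L: "lab us ls ` pts (length us) (length ls) = labs us \<union> labs ls"
  proof (intro equalityI subsetI)
    fix l assume "l \<in> labs us \<union> labs ls"
    then consider i where "i < length us" "snd (us ! i) = l" | i where "i < length ls" "snd (ls ! i) = l"
      by (auto simp: in_set_conv_nth)
    then show "l \<in> lab us ls ` pts (length us) (length ls)"
    proof cases
      case 1 then show ?thesis by (intro image_eqI[of _ _ "(False, i)"]) auto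
    next
      case 2 then show ?thesis by (intro image_eqI[of _ _ "(True, i)"]) auto
    qed
  qed (auto simp: pts_def)
  show ?thesis unfolding lpart_sel kerp_def L[symmetric] image_image ..
qed

lemma C_Gamma_lpart_iff:
  "lpart us ls \<in> C_Gamma d \<longleftrightarrow>
     noncrossing (lpart us ls) \<and> (\<forall>l \<in> labs us \<union> labs ls. gamma_eq d (fil l us) (fil l ls))"
proof -
  let ?B = "\<lambda>l. {s \<in> pts (length us) (length ls). lab us ls s = l}"
  have "ucols (lpart us ls) (?B l) = fil l us" "lcols (lpart us ls) (?B l) = fil l ls" for l
    using fil_conv_sorted_list[of us l] fil_conv_sorted_list[of ls l]
    by (simp_all add: ucols_def lcols_def)
  then show ?thesis unfolding C_Gamma_def mem_Collect_eq blocks_lpart by simp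
qed

lemma beta_part_lpart: "beta_part w w = lpart (lbl 1 w) (lbl 0 w)"
proof -
  define U :: "pt set" where "U = {(False, i) |i. i < length w}"
  define L :: "pt set" where "L = {(True, i) |i. i < length w}"
  let ?g = "lab (lbl 1 w) (lbl 0 w)"
  have A: "pts (length w) (length w) = U \<union> L" by (simp add: pts_def U_def L_def)
  have gU: "?g t = 1" if "t \<in> U" for t using that by (auto simp: U_def)
  have gL: "?g t = 0" if "t \<in> L" for t using that by (auto simp: L_def)
  have clU: "{s \<in> U \<union> L. ?g s = ?g t} = U" if "t \<in> U" for t
    using gU gL gU[OF that] by (auto simp del: lab.simps)
  have clL: "{s \<in> U \<union> L. ?g s = ?g t} = L" if "t \<in> L" for t
    using gU gL gL[OF that] by (auto simp del: lab.simps)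
  have "(\<lambda>t. {s \<in> U \<union> L. ?g s = ?g t}) ` U = (\<lambda>_. U) ` U" by (rule image_cong[OF HOL.refl clU])
  moreover have "(\<lambda>t. {s \<in> U \<union> L. ?g s = ?g t}) ` L = (\<lambda>_. L) ` L" by (rule image_cong[OF HOL.refl clL])
  ultimately have "kerp (U \<union> L) ?g = (\<lambda>_. U) ` U \<union> (\<lambda>_. L) ` L"
    unfolding kerp_def image_Un by (simp only:)
  \<comment> \<open>For \<open>w = []\<close> both sides are empty.\<close>
  moreover have "\<dots> = {U, L} - {{}}" by auto
  ultimately show ?thesis
    by (simp add: beta_part_def lpart_def A U_def[symmetric] L_def[symmetric] o_def)
qed

lemma (in category) beta_part_in_iff: "beta_part w w \<in> C \<longleftrightarrow> lbl 0 w @ rev (lbl 1 w) \<in> R"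
  by (simp add: beta_part_lpart lpart_in_iff)

context abba_category
begin

text \<open>Interval blocks are removed one at a time; each has trivial product, so it is a
  one-block word of the category and can be inserted again.\<close>

lemma trivial_blocks_in_R:
  assumes "lbl 0 (xy_pow d) \<in> R" "ncl xs" "\<And>l. gamma_eq d (fil l xs) []"
  shows "xs \<in> R"
  using assms(2,3)
proof (induction xs rule: length_induct)
  case (1 xs)
  show ?case
  proof (cases "xs = []")
    case True
    then show ?thesis using R_Nil by simp
  next
    case False
    then obtain u b v l where ub: "xs = u @ b @ v" "b \<noteq> []" "labs b \<subseteq> {l}" "l \<notin> labs (u @ v)"
      using interval_block_all[OF 1(2)] by blast
    have fu: "fil l u = []" "fil l v = []" using ub(4) by (auto simp: filter_empty_conv)
    have fb: "filter (\<lambda>x. snd x = l) b = b" using ub(3) by (auto intro: filter_True)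
    have "fil l xs = map fst b" using ub(1) fu fb by simp
    then have "lbl 0 (map fst b) \<in> R"
      using one_block_gamma_eq[OF 1(3)[of l] assms(1), of "[]" "[]"] R_Nil by simp
    then have b: "b \<in> R" using R_lbl_iff[of l "map fst b" 0] lbl_map_fst[OF ub(3)] by simp
    have "gamma_eq d (fil k (u @ v)) []" for k
    proof (cases "k = l")
      case True
      then show ?thesis using fu by (simp add: gamma_eq.refl)
    next
      case False
      then have "filter (\<lambda>x. snd x = k) b = []" using ub(3) by (auto simp: filter_empty_conv)
      then have "fil k (u @ v) = fil k xs" using ub(1) by simp
      then show ?thesis using 1(3)[of k] by simp
    qed
    moreover have "ncl (u @ v)" using ncl_remove 1(2) ub(1) by blast
    moreover have "length (u @ v) < length xs" using ub(1,2) by simp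
    ultimately have uv: "u @ v \<in> R" using 1(1) by blast
    have "labs b \<inter> labs (u @ v) = {}" using ub(3,4) by blast
    from R_insert[OF uv b this] show ?thesis using ub(1) by simp
  qed
qed

text \<open>Lowering the upper row reverses, hence inverts, its colour products: equality of the
  upper and lower products of a block becomes triviality of its product in the one-row word.\<close>

lemma C_Gamma_subset:
  assumes "lbl 0 (xy_pow d) \<in> R" shows "C_Gamma d \<subseteq> C"
proof
  fix p assume p: "p \<in> C_Gamma d"
  then have "wf_part p" by (simp add: C_Gamma_def noncrossing_def)
  then obtain us ls where ul: "p = lpart us ls" using wf_part_lpart by blast
  have g: "gamma_eq d (fil l us) (fil l ls)" for l
  proof (cases "l \<in> labs us \<union> labs ls")
    case True
    then show ?thesis using p ul C_Gamma_lpart_iff by blast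
  next
    case False
    then have "filter (\<lambda>x. snd x = l) us = []" "filter (\<lambda>x. snd x = l) ls = []"
      by (auto simp: filter_empty_conv)
    then show ?thesis by (simp add: gamma_eq.refl)
  qed
  have "gamma_eq d (fil l (ls @ rev us)) []" for l
  proof -
    have "gamma_eq d (fil l ls @ rev (fil l us)) (fil l us @ rev (fil l us))"
      using gamma_eq_cong[OF gamma_eq.sym[OF g[of l]], of "[]" "rev (fil l us)"] by simp
    then have "gamma_eq d (fil l ls @ rev (fil l us)) []"
      using gamma_eq_rev_cancel gamma_eq.trans by blast
    then show ?thesis by (simp add: rev_map rev_filter)
  qed
  moreover have "ncl (ls @ rev us)" using p ul C_Gamma_lpart_iff noncrossing_lpart by blast
  ultimately have "ls @ rev us \<in> R" using trivial_blocks_in_R[OF assms] by blast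
  then show "p \<in> C" using ul lpart_in_iff by simp
qed

end

section \<open>Recovering the category from its one-block and two-block words\<close>

locale even_abba_category = even_category + abba_category
begin

text \<open>The normal form of \<open>w\<close> is a power of \<open>xy\<close> or the inverse of
  one; by invariance that power is a one-block word, so \<open>d\<close> divides its
  exponent.\<close>

lemma even_word_one_block:
  assumes d: "\<And>k. lbl 0 (xy_pow k) \<in> R \<Longrightarrow> d dvd k" and dO: "lbl 0 (xy_pow d) \<in> R"
    and w: "even (length w)" "lbl 0 w \<in> R"
  shows "gamma_eq d w []"
proof -
  have tr: "gamma_eq d (xy_pow k) []" if "lbl 0 (xy_pow k) \<in> R" for k
    using d[OF that] gamma_eq_xy_pow_mult by (auto elim!: dvdE)
  have inv: "lbl 0 z \<in> R" if "gamma_eq d w z" for z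
    using one_block_gamma_eq[OF that dO, of "[]" "[]"] w(2) by simp
  obtain k where "gamma_eq d w (xy_pow k) \<or> gamma_eq d w (yx_pow k)"
    using gamma_eq_normal_form[OF w(1)] by blast
  then show ?thesis
  proof
    assume k: "gamma_eq d w (xy_pow k)"
    then show ?thesis using tr[OF inv[OF k]] gamma_eq.trans by blast
  next
    assume k: "gamma_eq d w (yx_pow k)"
    have "lbl 0 (rev (yx_pow k)) \<in> R" using one_block_rev[OF inv[OF k]] .
    then have "gamma_eq d (rev (xy_pow k)) []"
      using tr gamma_eq_rev_Nil rev_xy_pow by (metis rev_rev_ident)
    then show ?thesis using k gamma_eq.trans by (metis rev_xy_pow)
  qed
qed

lemma even_word_two_block:
  assumes n: "\<And>k. two_block (xy_pow k) \<Longrightarrow> n dvd k" and dO: "lbl 0 (xy_pow d) \<in> R"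
    and w: "even (length w)" "two_block w"
  shows "in_Lambda d n w"
proof -
  obtain k where k: "gamma_eq d w (xy_pow k) \<or> gamma_eq d w (yx_pow k)"
    using gamma_eq_normal_form[OF w(1)] by blast
  have "two_block (xy_pow k)"
    using k
  proof
    assume "gamma_eq d w (yx_pow k)"
    then have "two_block (yx_pow k)" using two_block_gamma_eq dO w(2) by blast
    then show ?thesis using two_block_rev rev_xy_pow by (metis rev_rev_ident)
  qed (use two_block_gamma_eq dO w(2) in blast)
  then obtain m where "k = n * m" using n by (auto elim: dvdE)
  then show ?thesis using k unfolding in_Lambda_def by blast
qed

lemma two_block_in_Lambda:
  assumes "in_Lambda d n w" "lbl 0 (xy_pow d) \<in> R" "two_block (xy_pow n)"
  shows "two_block w"
proof -
  have xy: "two_block (xy_pow (n * k))" for k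
  proof (induction k)
    case (Suc k)
    then show ?case using two_block_append[OF assms(3) Suc] by (simp add: xy_pow_add)
  qed (simp add: two_block_Nil)
  then have yx: "two_block (yx_pow (n * k))" for k using two_block_rev rev_xy_pow by metis
  show ?thesis
    using assms(1) two_block_gamma_eq[OF gamma_eq.sym assms(2)] xy yx unfolding in_Lambda_def by blast
qed

text \<open>An interval block is first merged into a neighbouring block and then split off again with
  the two-block partition of its colour word.\<close>

lemma lwords_subset:
  assumes G: "category G"
    and one: "\<And>w l. even (length w) \<Longrightarrow> lbl l w \<in> R \<Longrightarrow> lbl l w \<in> lwords G"
    and two: "\<And>w. even (length w) \<Longrightarrow> two_block w \<Longrightarrow> lbl 0 w @ rev (lbl 1 w) \<in> lwords G"
  shows "xs \<in> R \<Longrightarrow> xs \<in> lwords G"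
proof (induction "card (labs xs)" arbitrary: xs rule: less_induct)
  case less
  interpret G: category G by (rule G)
  show ?case
  proof (cases "xs = []")
    case True
    then show ?thesis using G.R_Nil by simp
  next
    case False
    then obtain u b v l where ub: "xs = u @ b @ v" "b \<noteq> []" "labs b \<subseteq> {l}" "l \<notin> labs (u @ v)"
      using interval_block_all[OF R_ncl[OF less.prems]] by blast
    define w where "w = map fst b"
    define r where "r = v @ u"
    have b: "b = lbl l w" using lbl_map_fst[OF ub(3)] by (simp add: w_def)
    have ev: "even (length w)" using even_interval[of u b v l] less.prems ub by (simp add: w_def)
    have lr: "l \<notin> labs r" using ub(4) by (auto simp: r_def)
    have wne: "w \<noteq> []" using ub(2) by (simp add: w_def)
    have br: "b @ r \<in> R" using R_rotate[of u "b @ v"] less.prems ub(1) by (simp add: r_def)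
    have "r @ b \<in> G.R"
    proof (cases r rule: rev_cases)
      case Nil
      then show ?thesis using one[OF ev, of l] br b by simp
    next
      case (snoc r' x)
      obtain a k where x: "x = (a, k)" by (cases x)
      obtain c w' where w': "w = c # w'" using wne by (cases w) auto
      \<comment> \<open>Merging the first letter of \<open>b\<close> with the last letter of
        \<open>r\<close> gives the whole block the label \<open>k\<close>. The label
        \<open>l\<close> disappears, so the induction on the number of labels applies.\<close>
      have "r' @ [(a, k), (c, l)] @ lbl l w' \<in> R"
        using R_rotate[OF br] by (simp add: snoc x b w')
      from R_merge[OF this] have "relabel (mrg k l) (r @ lbl l w) \<in> R" by (simp add: snoc x w')
      moreover have "relabel (mrg k l) r = r" using lr by (rule relabel_fresh)
      moreover have "relabel (mrg k l) (lbl l w) = lbl k w" by simp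
      ultimately have rk: "r @ lbl k w \<in> R" by (simp only: map_append)
      have kr: "k \<in> labs r" by (simp add: snoc x)
      have lw: "labs (lbl j w) = {j}" for j using wne labs_lbl[of j w] by (simp only: if_False)
      have labk: "labs (r @ lbl k w) = labs r" unfolding set_append image_Un lw using kr by blast
      have "labs xs = insert l (labs r)" unfolding ub(1) r_def b set_append image_Un lw by blast
      then have "card (labs (r @ lbl k w)) < card (labs xs)" unfolding labk using lr by simp
      from less.hyps[OF this rk] have rkG: "r @ lbl k w \<in> G.R" .
      have "two_block w" using R_beta[OF br ub(3) lr] by (simp add: two_block_def w_def)
      then have be: "lbl 0 w @ rev (lbl 1 w) \<in> G.R" using two[OF ev] by blast
      \<comment> \<open>With a fresh label \<open>M\<close>, a rotation of \<open>beta(w,w)\<close>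
        reads \<open>rev (lbl M w) @ lbl l w\<close>. Its first half cancels the merged copy
        \<open>lbl k w\<close>, and its second half restores the separate block.\<close>
      obtain M where M: "\<forall>j\<in>labs ((a, l) # r). j < M" using fresh_label by blast
      then have Ml: "l \<noteq> M" by fastforce
      have Mr: "M \<notin> labs r"
      proof
        assume "M \<in> labs r"
        then have "M \<in> labs ((a, l) # r)" by simp
        from bspec[OF M this] show False by simp
      qed
      have "lbl l w @ rev (lbl M w) \<in> G.R" using be G.R_lbl2_iff[OF Ml, of 0 1 w w] by simp
      then have "rev (lbl M w) @ lbl l w \<in> G.R" by (rule G.R_rotate)
      moreover have "labs (r @ lbl k w) \<inter> labs (rev (lbl M w) @ lbl l w) = {}"
        unfolding labk set_append set_rev image_Un lw using lr Mr kr by blast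
      ultimately have "(r @ lbl k w) @ (rev (lbl M w) @ lbl l w) \<in> G.R"
        by (rule G.R_append[OF rkG])
      then have "r @ lbl k w @ rev (lbl M w) @ lbl l w \<in> G.R" by simp
      from G.R_cancel[OF this wne] have "relabel (mrg k M) r @ relabel (mrg k M) (lbl l w) \<in> G.R"
        by (simp only: map_append)
      moreover have "relabel (mrg k M) r = r" using Mr by (rule relabel_fresh)
      moreover have "relabel (mrg k M) (lbl l w) = lbl l w" using Ml by simp
      ultimately show ?thesis by (simp only: b)
    qed
    then have "v @ (u @ b) \<in> G.R" by (simp add: r_def)
    from G.R_rotate[OF this] show ?thesis using ub(1) by simp
  qed
qed

theorem classification: "\<exists>d n. n dvd d \<and> C = C_Gamma_Lambda d n"
proof -
  obtain d where d: "lbl 0 (xy_pow d) \<in> R" "\<And>k. lbl 0 (xy_pow k) \<in> R \<Longrightarrow> d dvd k"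
  proof (rule nat_subgroup_generator[of "{k. lbl 0 (xy_pow k) \<in> R}"])
    fix j k assume jk: "j \<in> {k. lbl 0 (xy_pow k) \<in> R}" "k \<in> {k. lbl 0 (xy_pow k) \<in> R}" "j \<le> k"
    then have "lbl 0 ([] @ xy_pow j @ xy_pow (k - j)) \<in> R" using xy_pow_add[of j "k - j"] by simp
    from one_block_remove[OF _ this] jk show "k - j \<in> {k. lbl 0 (xy_pow k) \<in> R}" by simp
  qed (use R_Nil in auto)
  obtain n where n: "two_block (xy_pow n)" "\<And>k. two_block (xy_pow k) \<Longrightarrow> n dvd k"
  proof (rule nat_subgroup_generator[of "{k. two_block (xy_pow k)}"])
    fix j k assume jk: "j \<in> {k. two_block (xy_pow k)}" "k \<in> {k. two_block (xy_pow k)}" "j \<le> k"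
    \<comment> \<open>The exponent is lowered by multiplying \<open>xy_pow k\<close> with the
      inverse of \<open>xy_pow j\<close> and reducing by \<open>gamma_eq d\<close>.\<close>
    have "xy_pow k = xy_pow (k - j) @ xy_pow j" using xy_pow_add[of "k - j" j] jk(3) by simp
    then have "two_block (xy_pow (k - j) @ (xy_pow j @ rev (xy_pow j)))"
      using two_block_append[OF _ two_block_rev, of "xy_pow k" "xy_pow j"] jk by simp
    moreover have "gamma_eq d (xy_pow (k - j) @ (xy_pow j @ rev (xy_pow j)) @ []) (xy_pow (k - j) @ [] @ [])"
      by (rule gamma_eq_cong[OF gamma_eq_rev_cancel])
    ultimately show "k - j \<in> {k. two_block (xy_pow k)}"
      using two_block_gamma_eq[OF _ d(1)] by simp
  qed (use two_block_Nil in auto)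
  \<comment> \<open>A one-block word next to its mirror image is a two-block word, so
    \<open>d\<close> is among the exponents that \<open>n\<close> divides.\<close>
  have "n dvd d" using n(2)[OF two_block_of_one_block[OF d(1)]] .
  define S where "S = C_Gamma d \<union> {beta_part w w | w. in_Lambda d n w}"
  have "beta_part w w \<in> C" if "in_Lambda d n w" for w
    using two_block_in_Lambda[OF that d(1) n(1)] beta_part_in_iff two_block_def by blast
  then have SC: "S \<subseteq> C" using C_Gamma_subset[OF d(1)] by (auto simp: S_def)
  define G where "G = gen_cat S"
  note G = gen_cat_category[OF is_cat SC, folded G_def]
  interpret G: category G using G(1) by unfold_locales
  have "xs \<in> G.R" if "xs \<in> R" for xs
  \<comment> \<open>It remains to find the even one-block words in \<open>C_Gamma d\<close> and the
    even two-block words among the generators \<open>beta_part w w\<close>.\<close>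
  proof (rule lwords_subset[OF G.category_axioms _ _ that])
    fix w l assume w: "even (length w)" "lbl l w \<in> R"
    have "lbl 0 w \<in> R" using w(2) R_lbl_iff by blast
    then have "gamma_eq d w []" using even_word_one_block[OF d(2,1) w(1)] by simp
    moreover have "fil l (lbl l w) = w" by (simp add: filter_map o_def)
    moreover have "noncrossing (lpart [] (lbl l w))" using w(2) cat_rules(1) by (simp add: lwords_def)
    ultimately have "lpart [] (lbl l w) \<in> C_Gamma d"
      unfolding C_Gamma_lpart_iff by (auto intro: gamma_eq.sym)
    then show "lbl l w \<in> G.R" using G(2) by (auto simp: S_def lwords_def)
  next
    fix w assume "even (length w)" "two_block w"
    then have "in_Lambda d n w" using even_word_two_block[OF n(2) d(1)] by simp
    then have "beta_part w w \<in> G" using G(2) by (auto simp: S_def)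
    then show "lbl 0 w @ rev (lbl 1 w) \<in> G.R" using G.beta_part_in_iff by blast
  qed
  then have "C \<subseteq> G" using category_subsetI[of C G] category_axioms G.category_axioms by blast
  then have "C = C_Gamma_Lambda d n" using G(3) unfolding C_Gamma_Lambda_def G_def S_def by blast
  then show ?thesis using \<open>n dvd d\<close> by blast
qed

end

theorem theorem6p6:
  fixes N :: nat and C :: "part set"
  assumes "N \<ge> 4"
    and "is_category C"
    and "pi_part [X] [Y] \<notin> C"
    and "\<not> free_product C"
    and "\<forall>p\<in>C. \<forall>B\<in>blocks p. even (card B)"
    and "\<exists>p\<in>C. \<exists>B\<in>blocks p. card B \<ge> 4"
  shows "\<exists>d n :: nat. n dvd d \<and> C = C_Gamma_Lambda d n"
proof -
  interpret even_category C
    using assms(2,5) by unfold_locales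
  \<comment> \<open>Without a mixed word, \<open>C\<close> would be a free product.\<close>
  obtain zs where zs: "zs \<in> R" "mixed zs"
    using unmixed_free_product assms(4) by blast
  obtain c where c: "lbl 0 [c, c, c, c] \<in> R"
    using four_block assms(6) by blast
  interpret even_abba_category C
    by unfold_locales (rule abba_in_R[OF zs c])
  show ?thesis by (rule classification)
qed

end
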